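(* Let $(\mathbf{v}_i)_{i\ge1}$ be $[0,1]$-valued random variables that are conditionally i.i.d. given $\boldsymbol{\nu}$ with law $\boldsymbol{\nu}$, where $\boldsymbol{\nu}$ is a species sampling process on $[0,1]$ with base measure $\nu_0$, EPPF $\pi_\nu$ and tie probability $\rho_\nu$. Let $\mathbf{w}_1=\mathbf{v}_1$, $\mathbf{w}_j=\mathbf{v}_j\prod_{i<j}(1-\mathbf{v}_i)$. Let $c(v)=1\wedge v(1-v)^{-1}$ for $v\in[0,1]$ (with $c(1)=1$) and $\overrightarrow{\nu_0}(x)=\nu_0([0,x])$. Then for every $j\ge1$: (a) $\mathbb{P}[\mathbf{w}_j\ge\mathbf{w}_{j+1}]=\rho_\nu+(1-\rho_\nu)\,\mathbb{E}[\overrightarrow{\nu_0}(c(\mathbf{v}))]$, where $\mathbf{v}\sim\nu_0$. (b) Almost surely, $$\mathbb{P}[\mathbf{w}_j\ge\mathbf{w}_{j+1}\mid\mathbf{w}_1,\dots,\mathbf{w}_j]=\mathbb{P}[\mathbf{v}_{j+1}\le c(\mathbf{v}_j)\mid\mathbf{v}_1,\dots,\mathbf{v}_j]=\sum_{i=1}^{\mathbf{K}_j}\frac{\pi_\nu(\mathbf{n}^{(i)})}{\pi_\nu(\mathbf{n})}\mathbf{1}_{\{\mathbf{v}^*_i\le c(\mathbf{v}_j)\}}+\frac{\pi_\nu(\mathbf{n}^{(\mathbf{K}_j+1)})}{\pi_\nu(\mathbf{n})}\overrightarrow{\nu_0}(c(\mathbf{v}_j)),$$ where $\mathbf{v}^*_1,\dots,\mathbf{v}^*_{\mathbf{K}_j}$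 are the distinct values among $\mathbf{v}_1,\dots,\mathbf{v}_j$, $\mathbf{n}=(\mathbf{n}_1,\dots,\mathbf{n}_{\mathbf{K}_j})$ with $\mathbf{n}_i=|\{l\le j:\mathbf{v}_l=\mathbf{v}^*_i\}|$, $\mathbf{n}^{(i)}$ is $\mathbf{n}$ with its $i$-th entry increased by one, and $\mathbf{n}^{(\mathbf{K}_j+1)}=(\mathbf{n}_1,\dots,\mathbf{n}_{\mathbf{K}_j},1)$.
   Context: A species sampling process on $[0,1]$ with base measure $\nu_0$ (a diffuse probability measure) is a random probability measure $\boldsymbol{\nu}=\sum_{j\ge1}\mathbf{p}_j\delta_{\boldsymbol{\eta}_j}+(1-\sum_j\mathbf{p}_j)\nu_0$ with $\mathbf{p}_j\ge0$, $\sum_j\mathbf{p}_j\le1$ a.s., independent of i.i.d. atoms $\boldsymbol{\eta}_j\sim\nu_0$. For a sequence $(\mathbf{v}_i)$ conditionally i.i.d. from $\boldsymbol{\nu}$, let $\boldsymbol{\Pi}(\mathbf{v}_{1:n})$ be the random partition of $\{1,\dots,n\}$ with $i,l$ in the same block iff $\mathbf{v}_i=\mathbf{v}_l$; the EPPF is the symmetric function $\pi_\nu$ with $\mathbb{P}[\boldsymbol{\Pi}(\mathbf{v}_{1:n})=\{A_1,\dots,A_k\}]=\pi_\nu(|A_1|,\dots,|A_k|)$ for every partition. The tie probability is $\rho_\nu=\pi_\nu(2)=\mathbb{P}[\mathbf{v}_1=\mathbf{v}_2]$. *)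

theory Defs
  imports "HOL-Probability.Probability" "HOL-Library.Multiset" "HOL-Library.Disjoint_Sets"
begin

definition gen_sa :: "'a measure \<Rightarrow> ('i \<Rightarrow> 'a \<Rightarrow> real) \<Rightarrow> 'i set \<Rightarrow> 'a measure" where
  "gen_sa M X I = sigma (space M) {X i -` B \<inter> space M | i B. i \<in> I \<and> B \<in> sets borel}"

definition ssp_measure :: "real measure \<Rightarrow> (nat \<Rightarrow> 'a \<Rightarrow> real) \<Rightarrow> (nat \<Rightarrow> 'a \<Rightarrow> real)
    \<Rightarrow> 'a \<Rightarrow> real set \<Rightarrow> real" where
  "ssp_measure \<nu>0 p eta \<omega> A =
     (\<Sum>j. p j \<omega> * indicator A (eta j \<omega>)) + (1 - (\<Sum>j. p j \<omega>)) * measure \<nu>0 A"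

definition tie_partition :: "(nat \<Rightarrow> 'a \<Rightarrow> real) \<Rightarrow> nat \<Rightarrow> 'a \<Rightarrow> nat set set" where
  "tie_partition v n \<omega> = (\<lambda>i. {l \<in> {1..n}. v l \<omega> = v i \<omega>}) ` {1..n}"

text \<open>Multiset of block sizes of a partition (EPPFs are symmetric, so they are
  functions of the multiset of block sizes).\<close>
definition block_sizes :: "nat set set \<Rightarrow> nat multiset" where
  "block_sizes P = image_mset card (mset_set P)"

definition stick :: "(nat \<Rightarrow> 'a \<Rightarrow> real) \<Rightarrow> nat \<Rightarrow> 'a \<Rightarrow> real" where
  "stick v j \<omega> = v j \<omega> * (\<Prod>i\<in>{1..<j}. (1 - v i \<omega>))"

definition cfun :: "real \<Rightarrow> real" where
  "cfun x = (if x = 1 then 1 else min 1 (x / (1 - x)))"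

definition cdf0 :: "real measure \<Rightarrow> real \<Rightarrow> real" where
  "cdf0 \<nu>0 x = measure \<nu>0 {0..x}"

definition distinct_vals :: "(nat \<Rightarrow> 'a \<Rightarrow> real) \<Rightarrow> nat \<Rightarrow> 'a \<Rightarrow> real set" where
  "distinct_vals v j \<omega> = (\<lambda>l. v l \<omega>) ` {1..j}"

definition mult_count :: "(nat \<Rightarrow> 'a \<Rightarrow> real) \<Rightarrow> nat \<Rightarrow> 'a \<Rightarrow> real \<Rightarrow> nat" where
  "mult_count v j \<omega> x = card {l \<in> {1..j}. v l \<omega> = x}"

definition count_vec :: "(nat \<Rightarrow> 'a \<Rightarrow> real) \<Rightarrow> nat \<Rightarrow> 'a \<Rightarrow> nat multiset" where
  "count_vec v j \<omega> = image_mset (mult_count v j \<omega>) (mset_set (distinct_vals v j \<omega>))"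

definition pred_formula :: "(nat multiset \<Rightarrow> real) \<Rightarrow> real measure \<Rightarrow> (nat \<Rightarrow> 'a \<Rightarrow> real)
    \<Rightarrow> nat \<Rightarrow> 'a \<Rightarrow> real" where
  "pred_formula \<pi> \<nu>0 v j \<omega> =
     (let n = count_vec v j \<omega>; t = cfun (v j \<omega>) in
       (\<Sum>x\<in>distinct_vals v j \<omega>.
          \<pi> (add_mset (mult_count v j \<omega> x + 1) (n - {#mult_count v j \<omega> x#})) / \<pi> n
            * indicator {..t} x)
       + \<pi> (add_mset 1 n) / \<pi> n * cdf0 \<nu>0 t)"

end

theory Submission
  imports Defs
begin

text \<open>Write the species sampling process as a mixture over a random index \<open>k\<close>: with weight
  \<open>1 - (\<Sum>j. p\<^sub>j)\<close> (index \<open>0\<close>) one draws from \<open>\<nu>\<^sub>0\<close>, with weight \<open>p\<^sub>k\<close> (index \<open>Suc k\<close>) one takes the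
  atom \<open>\<eta>\<^sub>k\<close>. Expanding \<open>\<Prod>\<^sub>i \<nu>(A\<^sub>i)\<close> over index vectors \<open>J\<close> and integrating out the atoms, which are
  i.i.d. and independent of the weights, shows that the law of \<open>(v\<^sub>1, \<dots>, v\<^sub>n)\<close> is a mixture over the partitions of
  \<open>{1..n}\<close> of the laws of vectors that are constant on the blocks, with i.i.d. \<open>\<nu>\<^sub>0\<close>-distributed values on distinct
  blocks. Since \<open>\<nu>\<^sub>0\<close> is diffuse these laws live on disjoint sets, so the mixing coefficients are the values of the EPPF.
  Comparing the mixtures for \<open>j\<close> and \<open>j + 1\<close> gives the prediction rule and hence (b); the case of two
  observations together with stationarity gives (a). The comparison \<open>w\<^sub>j\<^sub>+\<^sub>1 \<le> w\<^sub>j\<close> is \<open>v\<^sub>j\<^sub>+\<^sub>1 \<le> c(v\<^sub>j)\<close> off the null event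
  that some \<open>v\<^sub>i = 1\<close>, and off this event \<open>v\<^sub>i = w\<^sub>i / (1 - \<Sum>\<^sub>l\<^sub><\<^sub>i w\<^sub>l)\<close>, so that \<open>w\<close> and \<open>v\<close> carry the same information.\<close>

section \<open>Canonical representatives of kernels\<close>

text \<open>A partition of \<open>{1..n}\<close> is encoded as a function that sends each index to
  the least element of its block. Such a code can be composed with a vector of block values, which a
  set of blocks cannot. Outside \<open>{1..n}\<close> it is \<open>undefined\<close>, so that equal
  kernels give equal functions.\<close>

definition rep :: "nat \<Rightarrow> (nat \<Rightarrow> 'b) \<Rightarrow> nat \<Rightarrow> nat" where
  "rep n x = (\<lambda>i\<in>{1..n}. LEAST l. l \<in> {1..n} \<and> x l = x i)"

text \<open>The fixed points of \<open>rep n\<close> are precisely the values it takes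
  (\<open>rep_in_reps\<close>), so there is one code per partition of \<open>{1..n}\<close>.\<close>

definition reps :: "nat \<Rightarrow> (nat \<Rightarrow> nat) set" where
  "reps n = {r. rep n r = r}"

text \<open>Blocks are named by the distinct values of \<open>x\<close>. This has the shape of
  \<open>count_vec\<close>; \<open>block_sizes_classes\<close> connects it with the sets of blocks
  on which the EPPF is given.\<close>

definition bsizes :: "nat \<Rightarrow> (nat \<Rightarrow> 'b) \<Rightarrow> nat multiset" where
  "bsizes n x = image_mset (\<lambda>y. card {l \<in> {1..n}. x l = y}) (mset_set (x ` {1..n}))"

lemma rep_props:
  assumes "i \<in> {1..n}"
  shows rep_mem: "rep n x i \<in> {1..n}" and rep_val: "x (rep n x i) = x i" and rep_le: "rep n x i \<le> i"
proof -
  have "(LEAST l. l \<in> {1..n} \<and> x l = x i) \<in> {1..n} \<and> x (LEAST l. l \<in> {1..n} \<and> x l = x i) = x i"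
    using assms LeastI[of "\<lambda>l. l \<in> {1..n} \<and> x l = x i" i] by simp
  moreover have "(LEAST l. l \<in> {1..n} \<and> x l = x i) \<le> i"
    using assms Least_le[of "\<lambda>l. l \<in> {1..n} \<and> x l = x i" i] by simp
  ultimately show "rep n x i \<in> {1..n}" "x (rep n x i) = x i" "rep n x i \<le> i"
    using assms by (simp_all add: rep_def)
qed

lemma rep_eq_iff:
  assumes "i \<in> {1..n}" "l \<in> {1..n}"
  shows "rep n x i = rep n x l \<longleftrightarrow> x i = x l"
proof
  assume "rep n x i = rep n x l"
  then show "x i = x l" using rep_val[of i n x] rep_val[of l n x] assms by simp
qed (use assms in \<open>simp add: rep_def\<close>)

text \<open>The least element is taken over a set that depends on the vector only through its
  equality pattern; conversely \<open>rep_eq_iff\<close> reads the pattern off the code.\<close>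

lemma rep_cong_iff:
  "rep n x = rep n y \<longleftrightarrow> (\<forall>i\<in>{1..n}. \<forall>l\<in>{1..n}. x i = x l \<longleftrightarrow> y i = y l)"
proof
  assume "rep n x = rep n y"
  then show "\<forall>i\<in>{1..n}. \<forall>l\<in>{1..n}. x i = x l \<longleftrightarrow> y i = y l"
    using rep_eq_iff[of _ n _ x, symmetric] rep_eq_iff[of _ n _ y] by simp
next
  assume a: "\<forall>i\<in>{1..n}. \<forall>l\<in>{1..n}. x i = x l \<longleftrightarrow> y i = y l"
  have "(LEAST l. l \<in> {1..n} \<and> x l = x i) = (LEAST l. l \<in> {1..n} \<and> y l = y i)" if "i \<in> {1..n}" for i
    using a that by (intro arg_cong[where f = Least] ext) blast
  then show "rep n x = rep n y"
    unfolding rep_def by (intro restrict_ext) simp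
qed

lemma rep_rep: "rep n (rep n x) = rep n x"
  unfolding rep_cong_iff by (simp add: rep_eq_iff)

lemma rep_in_reps: "rep n x \<in> reps n"
  by (simp add: reps_def rep_rep)

lemma reps_props:
  assumes "r \<in> reps n" "i \<in> {1..n}"
  shows reps_mem: "r i \<in> {1..n}" and reps_idem: "r (r i) = r i"
  using rep_props[OF assms(2), of r] assms(1) unfolding reps_def by simp_all

lemma reps_ext: "r \<in> reps n \<Longrightarrow> i \<notin> {1..n} \<Longrightarrow> r i = undefined"
proof -
  assume r: "r \<in> reps n" and i: "i \<notin> {1..n}"
  have "r i = rep n r i" using r by (simp add: reps_def)
  also have "\<dots> = undefined" using i by (simp only: rep_def restrict_apply if_False)
  finally show ?thesis .
qed

lemma finite_reps: "finite (reps n)"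
proof (rule finite_subset)
  show "reps n \<subseteq> {1..n} \<rightarrow>\<^sub>E {1..n}"
    using reps_mem reps_ext by (fastforce simp: PiE_iff extensional_def)
qed (simp add: finite_PiE)

lemma rep_eq_reps_iff:
  assumes "r \<in> reps n"
  shows "rep n x = r \<longleftrightarrow> (\<forall>i\<in>{1..n}. \<forall>l\<in>{1..n}. x i = x l \<longleftrightarrow> r i = r l)"
  using assms rep_cong_iff[of n x r] by (simp add: reps_def)

text \<open>Filling distinct blocks with distinct values creates no new coincidences. The values
  will come from a diffuse product law, where injectivity holds almost surely.\<close>

lemma rep_inj_comp:
  assumes "r \<in> reps n" "inj_on x {1..n}"
  shows "rep n (\<lambda>i\<in>{1..n}. x (r i)) = r"
  using assms reps_mem[OF assms(1)] by (simp add: rep_eq_reps_iff inj_on_eq_iff)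

section \<open>Partitions of \<open>j\<close> and of \<open>Suc j\<close> indices\<close>

lemma rep_Suc_less: "i \<in> {1..j} \<Longrightarrow> rep (Suc j) x i = rep j x i"
proof -
  assume i: "i \<in> {1..j}"
  have "rep (Suc j) x i \<le> i" using i by (intro rep_le) auto
  then have "rep (Suc j) x i \<in> {1..j}" "x (rep (Suc j) x i) = x i"
    using i rep_mem[of i "Suc j" x] rep_val[of i "Suc j" x] by auto
  then have "rep j x i \<le> rep (Suc j) x i"
    using i unfolding rep_def by (auto intro!: Least_le)
  moreover have "rep (Suc j) x i \<le> rep j x i"
    using i rep_mem[of i j x] rep_val[of i j x] by (subst rep_def) (auto intro!: Least_le)
  ultimately show ?thesis by simp
qed

lemma restrict_reps:
  assumes "r \<in> reps (Suc j)" shows "restrict r {1..j} \<in> reps j"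
proof -
  have "rep j (restrict r {1..j}) = rep j r" unfolding rep_cong_iff by simp
  also have "\<dots> = restrict r {1..j}"
  proof
    fix i show "rep j r i = restrict r {1..j} i"
    proof (cases "i \<in> {1..j}")
      case True
      then show ?thesis using rep_Suc_less[of i j r] assms by (simp add: reps_def)
    next
      case False
      then show ?thesis unfolding rep_def by (simp only: restrict_apply if_False)
    qed
  qed
  finally show ?thesis by (simp add: reps_def)
qed

text \<open>The last index either is the least element of its block, hence a singleton block, or
  joins a block whose least element is an older index; being a fixed point of \<open>r\<close>, that
  element lies in the image of the older indices.\<close>

lemma reps_Suc_last:
  assumes "r \<in> reps (Suc j)" shows "r (Suc j) \<in> insert (Suc j) (r ` {1..j})"
proof (cases "r (Suc j) = Suc j")
  case False
  have "r (Suc j) \<in> {1..Suc j}" "r (r (Suc j)) = r (Suc j)"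
    using reps_mem[OF assms, of "Suc j"] reps_idem[OF assms, of "Suc j"] by simp_all
  with False have "r (Suc j) \<in> r ` {1..j}" by (intro image_eqI[where x = "r (Suc j)"]) auto
  then show ?thesis by simp
qed simp

text \<open>Old minima are unaffected by a larger index (\<open>rep_Suc_less\<close>), and the new
  index receives either itself or the minimum of an old block, so the code stays canonical.\<close>

lemma reps_upd:
  assumes r: "r \<in> reps j" and b: "b \<in> insert (Suc j) (r ` {1..j})"
  shows "r(Suc j := b) \<in> reps (Suc j)"
proof -
  let ?r = "r(Suc j := b)"
  have "rep (Suc j) ?r i = ?r i" for i
  proof -
    consider "i \<in> {1..j}" | "i = Suc j" | "i \<notin> {1..Suc j}" by force
    then show ?thesis
    proof cases
      case 1
      have "rep j ?r = rep j r" unfolding rep_cong_iff by auto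
      then show ?thesis using 1 rep_Suc_less[of i j ?r] r by (auto simp: reps_def)
    next
      case 2
      show ?thesis
      proof (cases "b = Suc j")
        case True
        have "l = Suc j" if "l \<in> {1..Suc j}" "?r l = Suc j" for l
          using that reps_mem[OF r, of l] by (cases "l = Suc j") auto
        moreover have "rep (Suc j) ?r (Suc j) \<in> {1..Suc j}" by (rule rep_mem) simp
        moreover have "?r (rep (Suc j) ?r (Suc j)) = Suc j"
          using rep_val[of "Suc j" "Suc j" ?r] True by (simp only: fun_upd_same) simp
        ultimately have "rep (Suc j) ?r (Suc j) = Suc j" by blast
        then show ?thesis using 2 True by simp
      next
        case False
        then obtain l where l: "l \<in> {1..j}" "b = r l" using b by auto
        have bm: "b \<in> {1..j}" "r b = b" using reps_mem[OF r l(1)] reps_idem[OF r l(1)] l by auto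
        have "rep (Suc j) ?r (Suc j) = rep (Suc j) ?r b"
          using bm by (subst rep_eq_iff) auto
        also have "\<dots> = rep j ?r b" using bm rep_Suc_less by blast
        also have "rep j ?r = rep j r" unfolding rep_cong_iff by auto
        also have "rep j r b = b" using bm r by (simp add: reps_def)
        finally show ?thesis unfolding 2 fun_upd_same .
      qed
    next
      case 3
      then show ?thesis using reps_ext[OF r, of i] by (auto simp: rep_def)
    qed
  qed
  then show ?thesis by (auto simp: reps_def)
qed

text \<open>A partition of \<open>Suc j\<close> indices is a partition of \<open>j\<close> indices
  together with the block chosen by the last one: an old block, named by its minimum in the image of
  \<open>r\<close>, or a new one, named \<open>Suc j\<close>. The name \<open>Suc j\<close> is never
  an old one, which allows the sum to be split.\<close>

lemma sum_reps_Suc: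
  fixes f :: "(nat \<Rightarrow> nat) \<Rightarrow> 'c::comm_monoid_add"
  shows "(\<Sum>r\<in>reps (Suc j). f r) =
    (\<Sum>r\<in>reps j. (\<Sum>b\<in>r ` {1..j}. f (r(Suc j := b))) + f (r(Suc j := Suc j)))"
proof -
  have "(\<Sum>r\<in>reps (Suc j). f r) =
    (\<Sum>(r, b)\<in>(SIGMA r:reps j. insert (Suc j) (r ` {1..j})). f (r(Suc j := b)))"
  proof (rule sum.reindex_bij_witness[where i = "\<lambda>(r, b). r(Suc j := b)"
        and j = "\<lambda>r. (restrict r {1..j}, r (Suc j))"])
    fix r assume r: "r \<in> reps (Suc j)"
    have "restrict r {1..j} ` {1..j} = r ` {1..j}" by auto
    with r show "(restrict r {1..j}, r (Suc j)) \<in> (SIGMA r:reps j. insert (Suc j) (r ` {1..j}))"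
      using restrict_reps reps_Suc_last by auto
    have "(restrict r {1..j})(Suc j := r (Suc j)) = r"
    proof
      fix i show "((restrict r {1..j})(Suc j := r (Suc j))) i = r i"
        using reps_ext[OF r, of i] by (auto simp: restrict_def)
    qed
    then show "(case (restrict r {1..j}, r (Suc j)) of (r, b) \<Rightarrow> r(Suc j := b)) = r"
      "(case (restrict r {1..j}, r (Suc j)) of (r, b) \<Rightarrow> f (r(Suc j := b))) = f r" by simp_all
  next
    fix a assume a: "a \<in> (SIGMA r:reps j. insert (Suc j) (r ` {1..j}))"
    then obtain r b where ab: "a = (r, b)" "r \<in> reps j" "b \<in> insert (Suc j) (r ` {1..j})" by auto
    then show "(case a of (r, b) \<Rightarrow> r(Suc j := b)) \<in> reps (Suc j)"
      using reps_upd by simp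
    have "restrict (r(Suc j := b)) {1..j} = r"
    proof
      fix i show "restrict (r(Suc j := b)) {1..j} i = r i"
        using reps_ext[OF ab(2), of i] by (auto simp: restrict_def)
    qed
    then show "(restrict (case a of (r, b) \<Rightarrow> r(Suc j := b)) {1..j}, (case a of (r, b) \<Rightarrow> r(Suc j := b)) (Suc j)) = a"
      using ab by simp
  qed
  also have "\<dots> = (\<Sum>r\<in>reps j. \<Sum>b\<in>insert (Suc j) (r ` {1..j}). f (r(Suc j := b)))"
    by (rule sum.Sigma[symmetric]) (simp_all add: finite_reps)
  also have "\<dots> = (\<Sum>r\<in>reps j. (\<Sum>b\<in>r ` {1..j}. f (r(Suc j := b))) + f (r(Suc j := Suc j)))"
  proof (rule sum.cong[OF refl])
    fix r assume "r \<in> reps j"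
    then have "Suc j \<notin> r ` {1..j}" using reps_mem by fastforce
    then show "(\<Sum>b\<in>insert (Suc j) (r ` {1..j}). f (r(Suc j := b))) =
      (\<Sum>b\<in>r ` {1..j}. f (r(Suc j := b))) + f (r(Suc j := Suc j))"
      by (simp add: add.commute)
  qed
  finally show ?thesis .
qed

section \<open>Multisets of block sizes\<close>

lemma bsizes_upd_old:
  assumes "b \<in> x ` {1..j}"
  shows "bsizes (Suc j) (x(Suc j := b)) =
    add_mset (card {l \<in> {1..j}. x l = b} + 1) (bsizes j x - {#card {l \<in> {1..j}. x l = b}#})"
proof -
  let ?c = "\<lambda>y. card {l \<in> {1..j}. x l = y}" and ?d = "\<lambda>y. card {l \<in> {1..Suc j}. (x(Suc j := b)) l = y}"
  have im: "(x(Suc j := b)) ` {1..Suc j} = x ` {1..j}"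
    using assms by (auto simp: atLeastAtMostSuc_conv)
  have S: "mset_set (x ` {1..j}) = add_mset b (mset_set (x ` {1..j} - {b}))"
    using assms mset_set.insert[of "x ` {1..j} - {b}" b] by (simp add: insert_absorb)
  have "{l \<in> {1..Suc j}. (x(Suc j := b)) l = b} = insert (Suc j) {l \<in> {1..j}. x l = b}" by auto
  then have db: "?d b = ?c b + 1" by simp
  have "{l \<in> {1..Suc j}. (x(Suc j := b)) l = y} = {l \<in> {1..j}. x l = y}" if "y \<noteq> b" for y
    using that by auto
  then have dy: "?d y = ?c y" if "y \<noteq> b" for y using that by presburger
  have "bsizes (Suc j) (x(Suc j := b)) = add_mset (?c b + 1) (image_mset ?c (mset_set (x ` {1..j} - {b})))"
    unfolding bsizes_def im S image_mset_add_mset db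
    by (intro arg_cong[where f = "add_mset _"] image_mset_cong dy) auto
  moreover have "bsizes j x = add_mset (?c b) (image_mset ?c (mset_set (x ` {1..j} - {b})))"
    unfolding bsizes_def S by simp
  ultimately show ?thesis by simp
qed

text \<open>The new block is a singleton and the old fibres do not change. With
  \<open>bsizes_upd_old\<close> this yields the two kinds of enlarged size vector in the prediction
  rule.\<close>

lemma bsizes_upd_new:
  assumes "b \<notin> x ` {1..j}"
  shows "bsizes (Suc j) (x(Suc j := b)) = add_mset 1 (bsizes j x)"
proof -
  let ?c = "\<lambda>y. card {l \<in> {1..j}. x l = y}" and ?d = "\<lambda>y. card {l \<in> {1..Suc j}. (x(Suc j := b)) l = y}"
  have im: "(x(Suc j := b)) ` {1..Suc j} = insert b (x ` {1..j})"
    by (auto simp: atLeastAtMostSuc_conv)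
  have "{l \<in> {1..Suc j}. (x(Suc j := b)) l = b} = {Suc j}" using assms by auto
  then have db: "?d b = 1" by simp
  have "{l \<in> {1..Suc j}. (x(Suc j := b)) l = y} = {l \<in> {1..j}. x l = y}" if "y \<noteq> b" for y
    using that by auto
  then have dy: "?d y = ?c y" if "y \<noteq> b" for y using that by presburger
  have "image_mset ?d (mset_set (x ` {1..j})) = bsizes j x"
    unfolding bsizes_def using assms by (intro image_mset_cong dy) auto
  moreover have "mset_set (insert b (x ` {1..j})) = add_mset b (mset_set (x ` {1..j}))"
    using assms by simp
  ultimately show ?thesis
    unfolding bsizes_def[of "Suc j"] im by (simp only: image_mset_add_mset db)
qed

text \<open>Mapping a value in the range of \<open>x\<close> to its fibre is injective, since the
  fibre is nonempty; so counting over blocks and counting over values agree.\<close>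

lemma block_sizes_classes:
  "block_sizes ((\<lambda>i. {l \<in> {1..n}. x l = x i}) ` {1..n}) = bsizes n x"
proof -
  let ?g = "\<lambda>y. {l \<in> {1..n}. x l = y}"
  have "inj_on ?g (x ` {1..n})"
  proof (rule inj_onI)
    fix y z assume y: "y \<in> x ` {1..n}" and eq: "?g y = ?g z"
    from y obtain l where l: "l \<in> ?g y" "y = x l" by auto
    from eq l(1) have "l \<in> ?g z" by (rule subst)
    with l(2) show "y = z" by simp
  qed
  then have "mset_set (?g ` x ` {1..n}) = image_mset ?g (mset_set (x ` {1..n}))"
    by (simp add: image_mset_mset_set)
  moreover have "(\<lambda>i. {l \<in> {1..n}. x l = x i}) ` {1..n} = ?g ` x ` {1..n}" by auto
  ultimately show ?thesis
    by (simp add: block_sizes_def bsizes_def multiset.map_comp comp_def)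
qed

lemma classes_eqD:
  assumes eq: "(\<lambda>i. {l \<in> {1..n}. x l = x i}) ` {1..n} = (\<lambda>i. {l \<in> {1..n}. y l = y i}) ` {1..n}"
    and il: "i \<in> {1..n}" "l \<in> {1..n}" "x i = x l"
  shows "y i = y l"
proof -
  have "{l \<in> {1..n}. x l = x i} \<in> (\<lambda>i. {l \<in> {1..n}. y l = y i}) ` {1..n}"
    unfolding eq[symmetric] by (intro image_eqI[where x = i]) (use il(1) in simp_all)
  then obtain k where k: "{l \<in> {1..n}. x l = x i} = {l \<in> {1..n}. y l = y k}" by (elim imageE)
  have "i \<in> {l \<in> {1..n}. x l = x i}" "l \<in> {l \<in> {1..n}. x l = x i}" using il by auto
  then show ?thesis unfolding k by simp
qed

lemma classes_eq_iff:
  "(\<lambda>i. {l \<in> {1..n}. x l = x i}) ` {1..n} = (\<lambda>i. {l \<in> {1..n}. y l = y i}) ` {1..n}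
    \<longleftrightarrow> (\<forall>i\<in>{1..n}. \<forall>l\<in>{1..n}. x i = x l \<longleftrightarrow> y i = y l)" (is "?L \<longleftrightarrow> ?R")
proof
  assume L: ?L
  show ?R
  proof (intro ballI iffI)
    fix i l assume il: "i \<in> {1..n}" "l \<in> {1..n}"
    show "y i = y l" if "x i = x l" using classes_eqD[OF L il that] .
    show "x i = x l" if "y i = y l" using classes_eqD[OF L[symmetric] il that] .
  qed
next
  assume ?R
  then have "{l \<in> {1..n}. x l = x i} = {l \<in> {1..n}. y l = y i}" if "i \<in> {1..n}" for i
    using that by blast
  then show ?L by (rule image_cong[OF refl])
qed

lemma partition_on_classes:
  "partition_on {1..n} ((\<lambda>i. {l \<in> {1..n}. x l = x i}) ` {1..n})"
  by (rule partition_onI) (auto simp: disjnt_def)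

section \<open>Vectors constant on the blocks of a kernel\<close>

text \<open>Independence says that the joint law is the product of the marginals, and Tonelli
  separates the factors. Later \<open>X\<close> carries the weights and \<open>Y\<close> the
  atoms.\<close>

lemma (in prob_space) indep_var_nn_integral_mult:
  assumes ind: "indep_var S X T Y"
    and f [measurable]: "f \<in> borel_measurable S" and g [measurable]: "g \<in> borel_measurable T"
  shows "(\<integral>\<^sup>+\<omega>. f (X \<omega>) * g (Y \<omega>) \<partial>M) = (\<integral>\<^sup>+\<omega>. f (X \<omega>) \<partial>M) * (\<integral>\<^sup>+\<omega>. g (Y \<omega>) \<partial>M)"
proof -
  have [measurable]: "X \<in> measurable M S" "Y \<in> measurable M T"
    and eq: "distr M S X \<Otimes>\<^sub>M distr M T Y = distr M (S \<Otimes>\<^sub>M T) (\<lambda>x. (X x, Y x))"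
    using ind unfolding indep_var_distribution_eq by auto
  interpret Y: prob_space "distr M T Y" by (rule prob_space_distr) measurable
  have "(\<integral>\<^sup>+\<omega>. f (X \<omega>) * g (Y \<omega>) \<partial>M) = (\<integral>\<^sup>+z. f (fst z) * g (snd z) \<partial>distr M (S \<Otimes>\<^sub>M T) (\<lambda>x. (X x, Y x)))"
    by (subst nn_integral_distr) auto
  also have "\<dots> = (\<integral>\<^sup>+x. \<integral>\<^sup>+y. f x * g y \<partial>distr M T Y \<partial>distr M S X)"
    unfolding eq[symmetric] by (subst Y.nn_integral_fst[symmetric]) auto
  also have "\<dots> = (\<integral>\<^sup>+x. f x * (\<integral>\<^sup>+y. g y \<partial>distr M T Y) \<partial>distr M S X)"
    by (intro nn_integral_cong nn_integral_cmult) auto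
  also have "\<dots> = (\<integral>\<^sup>+x. f x \<partial>distr M S X) * (\<integral>\<^sup>+y. g y \<partial>distr M T Y)"
    by (intro nn_integral_multc) auto
  finally show ?thesis
    by (simp add: nn_integral_distr)
qed

text \<open>Finitely many coordinates in a countable set leave only countably many vectors, and each
  singleton is a measurable box. Hence every function of an index vector will be measurable.\<close>

lemma sets_PiM_count_space:
  fixes n :: nat
  shows "sets (PiM {1..n} (\<lambda>_. count_space (UNIV :: nat set))) = Pow ({1..n} \<rightarrow>\<^sub>E UNIV)"
proof
  show "sets (PiM {1..n} (\<lambda>_. count_space (UNIV :: nat set))) \<subseteq> Pow ({1..n} \<rightarrow>\<^sub>E UNIV)"
    using sets.space_closed[of "PiM {1..n} (\<lambda>_. count_space (UNIV :: nat set))"] by (simp add: space_PiM)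
  show "Pow ({1..n} \<rightarrow>\<^sub>E UNIV) \<subseteq> sets (PiM {1..n} (\<lambda>_. count_space (UNIV :: nat set)))"
  proof
    fix S :: "(nat \<Rightarrow> nat) set" assume S: "S \<in> Pow ({1..n} \<rightarrow>\<^sub>E UNIV)"
    have "countable ({1..n} \<rightarrow>\<^sub>E (UNIV :: nat set))" by (rule countable_PiE) auto
    then have "countable S" using S countable_subset by blast
    moreover have "{J} \<in> sets (PiM {1..n} (\<lambda>_. count_space (UNIV :: nat set)))" if "J \<in> S" for J
    proof -
      have "{J} = ({1..n} \<rightarrow>\<^sub>E UNIV) \<inter> {x. \<forall>i\<in>{1..n}. x i = J i}"
      proof (intro equalityI subsetI)
        have J: "J \<in> {1..n} \<rightarrow>\<^sub>E UNIV" using S that by blast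
        fix x
        show "x \<in> ({1..n} \<rightarrow>\<^sub>E UNIV) \<inter> {x. \<forall>i\<in>{1..n}. x i = J i}" if "x \<in> {J}"
          using that J by simp
        show "x \<in> {J}" if "x \<in> ({1..n} \<rightarrow>\<^sub>E UNIV) \<inter> {x. \<forall>i\<in>{1..n}. x i = J i}"
          using that PiE_ext[OF _ J, of x] by blast
      qed
      also have "\<dots> = (\<Pi>\<^sub>E i\<in>{1..n}. {J i})" by (auto simp: PiE_iff)
      also have "\<dots> \<in> sets (PiM {1..n} (\<lambda>_. count_space (UNIV :: nat set)))"
        by (rule sets_PiM_I_finite) auto
      finally show ?thesis .
    qed
    ultimately show "S \<in> sets (PiM {1..n} (\<lambda>_. count_space (UNIV :: nat set)))"
      by (rule sets.countable[rotated])
  qed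
qed

lemma borel_measurable_PiM_count_space:
  fixes n :: nat
  shows "f \<in> borel_measurable (PiM {1..n} (\<lambda>_. count_space (UNIV :: nat set)))"
  by (rule measurableI) (simp, unfold sets_PiM_count_space space_PiM space_count_space, blast)

lemma borel_measurable_indicator_pred:
  assumes "{x \<in> space M. P x} \<in> sets M"
  shows "(\<lambda>x. indicator {x. P x} x :: ennreal) \<in> borel_measurable M"
proof -
  have "(\<lambda>x. indicator {x \<in> space M. P x} x :: ennreal) \<in> borel_measurable M"
    using assms by simp
  also have "?this \<longleftrightarrow> ?thesis"
    by (rule measurable_cong) (simp add: indicator_def)
  finally show ?thesis .
qed

lemma emeasure_eq_nn_integral_Collect:
  assumes "{x \<in> space M. P x} \<in> sets M"
  shows "emeasure M {x \<in> space M. P x} = (\<integral>\<^sup>+x. indicator {x. P x} x \<partial>M)"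
proof -
  have "emeasure M {x \<in> space M. P x} = (\<integral>\<^sup>+x. indicator {x \<in> space M. P x} x \<partial>M)"
    using assms by simp
  also have "\<dots> = (\<integral>\<^sup>+x. indicator {x. P x} x \<partial>M)"
    by (intro nn_integral_cong) (auto simp: indicator_def)
  finally show ?thesis .
qed

section \<open>Products of a diffuse law\<close>

locale diffuse_prob = prob_space \<nu>0 for \<nu>0 :: "real measure" +
  assumes sets_nu0: "sets \<nu>0 = sets borel"
    and diffuse: "measure \<nu>0 {x} = 0"
begin

sublocale P: product_prob_space "\<lambda>_::nat. \<nu>0" UNIV
  by standard

lemma sets_PiM_nu0 [measurable_cong]: "sets (PiM I (\<lambda>_::nat. \<nu>0)) = sets (PiM I (\<lambda>_. borel))"
  by (rule sets_PiM_cong) (simp_all add: sets_nu0)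

lemma space_nu0 [simp]: "space \<nu>0 = UNIV"
  using sets_eq_imp_space_eq[OF sets_nu0] by simp

declare sets_nu0 [measurable_cong]

lemma nu0_singleton: "emeasure \<nu>0 {x} = 0"
  using diffuse[of x] by (simp add: emeasure_eq_measure)

lemma measurable_reindex [measurable]:
  assumes "r \<in> reps n"
  shows "(\<lambda>x. \<lambda>i\<in>{1..n}. x (r i)) \<in> measurable (PiM {1..n} (\<lambda>_. \<nu>0)) (PiM {1..n} (\<lambda>_. borel))"
  using reps_mem[OF assms]
  by (intro measurable_restrict) (simp add: measurable_component_singleton[where M = "\<lambda>_. borel"] cong: measurable_cong_sets)

text \<open>Integrating out coordinate \<open>i\<close> with the others fixed leaves the measure of
  the single point \<open>x l\<close>, which vanishes by diffuseness.\<close>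

lemma AE_PiM_distinct:
  assumes "finite I" "i \<in> I" "l \<in> I" "i \<noteq> l"
  shows "AE x in PiM I (\<lambda>_::nat. \<nu>0). x i \<noteq> x l"
proof -
  let ?J = "I - {i}"
  have I: "I = insert i ?J" "finite ?J" "i \<notin> ?J" using assms by auto
  have [measurable]: "(\<lambda>x. x i) \<in> borel_measurable (PiM I (\<lambda>_::nat. \<nu>0))" "(\<lambda>x. x l) \<in> borel_measurable (PiM I (\<lambda>_::nat. \<nu>0))"
    using assms by (simp_all add: measurable_cong_sets[OF sets_PiM_nu0 refl])
  have [measurable]: "(\<lambda>x. x i) \<in> borel_measurable (PiM I (\<lambda>_::nat. borel :: real measure))" "(\<lambda>x. x l) \<in> borel_measurable (PiM I (\<lambda>_::nat. borel :: real measure))"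
    using assms by simp_all
  have "emeasure (PiM I (\<lambda>_. \<nu>0)) {x \<in> space (PiM I (\<lambda>_. \<nu>0)). x i = x l}
    = (\<integral>\<^sup>+x. indicator {x. x i = x l} x \<partial>PiM I (\<lambda>_. \<nu>0))"
    by (intro emeasure_eq_nn_integral_Collect borel_measurable_eq) measurable
  also have "\<dots> = (\<integral>\<^sup>+x. indicator {x. x i = x l} x \<partial>PiM (insert i ?J) (\<lambda>_. \<nu>0))"
    using I(1) by simp
  also have "\<dots> = (\<integral>\<^sup>+x. \<integral>\<^sup>+y. indicator {x. x i = x l} (x(i := y)) \<partial>\<nu>0 \<partial>PiM ?J (\<lambda>_. \<nu>0))"
  proof (rule P.product_nn_integral_insert[OF I(2,3)])
    have "(\<lambda>x. indicator {x. x i = x l} x :: ennreal) \<in> borel_measurable (PiM I (\<lambda>_. \<nu>0))"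
      by (rule borel_measurable_indicator_pred[OF borel_measurable_eq]) measurable
    then show "(\<lambda>x. indicator {x. x i = x l} x :: ennreal) \<in> borel_measurable (PiM (insert i ?J) (\<lambda>_. \<nu>0))"
      using I(1) by simp
  qed
  also have "\<dots> = (\<integral>\<^sup>+x. \<integral>\<^sup>+y. indicator {x l} y \<partial>\<nu>0 \<partial>PiM ?J (\<lambda>_. \<nu>0))"
    using assms by (intro nn_integral_cong) (auto simp: indicator_def)
  also have "\<dots> = 0"
    by (simp add: sets_nu0 nu0_singleton)
  finally have "emeasure (PiM I (\<lambda>_. \<nu>0)) {x \<in> space (PiM I (\<lambda>_. \<nu>0)). x i = x l} = 0" .
  then show ?thesis
    by (intro AE_I[where N = "{x \<in> space (PiM I (\<lambda>_. \<nu>0)). x i = x l}"]) auto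
qed

lemma AE_PiM_inj_on:
  assumes "finite I"
  shows "AE x in PiM I (\<lambda>_::nat. \<nu>0). inj_on x I"
proof -
  have "AE x in PiM I (\<lambda>_::nat. \<nu>0). \<forall>i\<in>I. \<forall>l\<in>I. i \<noteq> l \<longrightarrow> x i \<noteq> x l"
    using assms AE_PiM_distinct[OF assms] by (intro AE_finite_allI) (auto intro: AE_I2)
  then show ?thesis
    by (rule AE_mp) (auto intro!: AE_I2 simp: inj_on_def)
qed

text \<open>A vector that is constant on blocks lies in a box iff each block value lies in the
  intersection of the sides belonging to its block, so the product measure factorises over blocks.
  Blocks are named by values of \<open>x\<close>, because the lemma will be used with
  \<open>x\<close> an \<open>atom_code\<close>.\<close>

lemma nn_integral_indicator_rep:
  fixes x :: "nat \<Rightarrow> 'b"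
  assumes A: "\<And>i. A i \<in> sets borel"
  shows "(\<integral>\<^sup>+z. indicator (\<Pi>\<^sub>E i\<in>{1..n}. A i) (\<lambda>i\<in>{1..n}. z (rep n x i)) \<partial>PiM {1..n} (\<lambda>_. \<nu>0)) =
    (\<Prod>y\<in>x ` {1..n}. emeasure \<nu>0 {z. \<forall>i\<in>{1..n}. x i = y \<longrightarrow> z \<in> A i})"
proof -
  let ?r = "rep n x"
  have meas: "{z. \<forall>i\<in>{1..n}. Q i \<longrightarrow> z \<in> A i} \<in> sets borel" for Q
  proof -
    have "{z. \<forall>i\<in>{1..n}. Q i \<longrightarrow> z \<in> A i} = (\<Inter>i\<in>{0..n}. if i \<in> {1..n} \<and> Q i then A i else UNIV)"
      by auto
    also have "\<dots> \<in> sets borel" using A by (intro sets.finite_INT) auto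
    finally show ?thesis .
  qed
  have "(\<integral>\<^sup>+z. indicator (\<Pi>\<^sub>E i\<in>{1..n}. A i) (\<lambda>i\<in>{1..n}. z (?r i)) \<partial>PiM {1..n} (\<lambda>_. \<nu>0)) =
    (\<integral>\<^sup>+z. indicator (\<Pi>\<^sub>E l\<in>{1..n}. {z. \<forall>i\<in>{1..n}. ?r i = l \<longrightarrow> z \<in> A i}) z \<partial>PiM {1..n} (\<lambda>_. \<nu>0))"
    using rep_mem[of _ n x]
    by (intro nn_integral_cong) (auto simp: indicator_def space_PiM PiE_iff)
  also have "\<dots> = emeasure (PiM {1..n} (\<lambda>_. \<nu>0)) (\<Pi>\<^sub>E l\<in>{1..n}. {z. \<forall>i\<in>{1..n}. ?r i = l \<longrightarrow> z \<in> A i})"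
    using meas by (intro nn_integral_indicator sets_PiM_I_finite) (auto simp: sets_nu0)
  also have "\<dots> = (\<Prod>l\<in>{1..n}. emeasure \<nu>0 {z. \<forall>i\<in>{1..n}. ?r i = l \<longrightarrow> z \<in> A i})"
    using meas by (intro P.emeasure_PiM) (auto simp: sets_nu0)
  \<comment> \<open>A coordinate that is not a block minimum is unconstrained and contributes the
    total mass 1.\<close>
  also have "\<dots> = (\<Prod>l\<in>?r ` {1..n}. emeasure \<nu>0 {z. \<forall>i\<in>{1..n}. ?r i = l \<longrightarrow> z \<in> A i})"
  proof (rule prod.mono_neutral_right)
    show "?r ` {1..n} \<subseteq> {1..n}" using rep_mem[of _ n x] by blast
    show "\<forall>l\<in>{1..n} - ?r ` {1..n}. emeasure \<nu>0 {z. \<forall>i\<in>{1..n}. ?r i = l \<longrightarrow> z \<in> A i} = 1"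
    proof
      fix l assume "l \<in> {1..n} - ?r ` {1..n}"
      then have "{z. \<forall>i\<in>{1..n}. ?r i = l \<longrightarrow> z \<in> A i} = space \<nu>0" by auto
      then show "emeasure \<nu>0 {z. \<forall>i\<in>{1..n}. ?r i = l \<longrightarrow> z \<in> A i} = 1"
        by (simp only: emeasure_space_1)
    qed
  qed simp
  \<comment> \<open>On the block minima \<open>x\<close> is injective and attains all its values, so
    it renames the blocks from minima to values.\<close>
  also have "\<dots> = (\<Prod>y\<in>x ` {1..n}. emeasure \<nu>0 {z. \<forall>i\<in>{1..n}. x i = y \<longrightarrow> z \<in> A i})"
  proof (rule prod.reindex_cong[where l = x, symmetric])
    have rr: "?r l = l" if "l \<in> ?r ` {1..n}" for l
      using that rep_rep[of n x] reps_idem[OF rep_in_reps] by blast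
    have rm: "l \<in> {1..n}" if "l \<in> ?r ` {1..n}" for l
      using that rep_mem[of _ n x] by blast
    show "inj_on x (?r ` {1..n})"
    proof (rule inj_onI)
      fix l m assume lm: "l \<in> ?r ` {1..n}" "m \<in> ?r ` {1..n}" "x l = x m"
      then have "?r l = ?r m" using rep_eq_iff[OF rm[OF lm(1)] rm[OF lm(2)], of x] by simp
      then show "l = m" using rr[OF lm(1)] rr[OF lm(2)] by simp
    qed
    show "x ` {1..n} = x ` ?r ` {1..n}"
      unfolding image_image using rep_val[of _ n x] by (intro image_cong) auto
    fix l assume l: "l \<in> ?r ` {1..n}"
    have "x i = x l \<longleftrightarrow> ?r i = l" if "i \<in> {1..n}" for i
      using rep_eq_iff[OF that rm[OF l], of x] rr[OF l] by simp
    then have "{z. \<forall>i\<in>{1..n}. x i = x l \<longrightarrow> z \<in> A i} = {z. \<forall>i\<in>{1..n}. ?r i = l \<longrightarrow> z \<in> A i}"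
      by blast
    then show "emeasure \<nu>0 {z. \<forall>i\<in>{1..n}. x i = x l \<longrightarrow> z \<in> A i} = emeasure \<nu>0 {z. \<forall>i\<in>{1..n}. ?r i = l \<longrightarrow> z \<in> A i}"
      by simp
  qed
  finally show ?thesis .
qed

end

section \<open>Species sampling samples\<close>

text \<open>Index \<open>0\<close> stands for the diffuse part of the process, index \<open>Suc k\<close> for its \<open>k\<close>-th atom.\<close>

definition mix_weight :: "(nat \<Rightarrow> real) \<Rightarrow> nat \<Rightarrow> ennreal" where
  "mix_weight x k = ennreal (case k of 0 \<Rightarrow> 1 - (\<Sum>k. x k) | Suc k \<Rightarrow> x k)"

definition mix_prob :: "real measure \<Rightarrow> real set \<Rightarrow> (nat \<Rightarrow> real) \<Rightarrow> nat \<Rightarrow> ennreal" where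
  "mix_prob \<nu>0 A y k = (case k of 0 \<Rightarrow> emeasure \<nu>0 A | Suc k \<Rightarrow> indicator A (y k))"

text \<open>Two draws of the same atom coincide, but two draws from the diffuse part never do; hence the
  position is kept in the latter case only.\<close>

definition atom_code :: "(nat \<Rightarrow> nat) \<Rightarrow> nat \<Rightarrow> nat \<times> nat" where
  "atom_code J i = (if J i = 0 then (0, i) else (J i, 0))"

lemma prod_indicator_PiE:
  "(\<Prod>i\<in>{1..n}. indicator (A i) (x i)) =
    (indicator (\<Pi>\<^sub>E i\<in>{1..n}. A i) (\<lambda>i\<in>{1..n::nat}. x i) :: 'c::comm_semiring_1)"
proof (cases "\<forall>i\<in>{1..n}. x i \<in> A i")
  case True
  then show ?thesis by (simp add: indicator_def PiE_iff)
next
  case False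
  then obtain i where i: "i \<in> {1..n}" "x i \<notin> A i" by blast
  then have "(\<lambda>i\<in>{1..n}. x i) \<notin> (\<Pi>\<^sub>E i\<in>{1..n}. A i)" by (auto simp: PiE_iff)
  moreover have "(\<Prod>i\<in>{1..n}. indicator (A i) (x i)) = (0 :: 'c)"
    using i by (intro prod_zero) (auto intro!: bexI[of _ i])
  ultimately show ?thesis by simp
qed

lemma sets_rep_eq:
  assumes r: "r \<in> reps n"
  shows "{x \<in> space (PiM {1..n} (\<lambda>_. borel :: real measure)). rep n x = r} \<in> sets (PiM {1..n} (\<lambda>_. borel))"
proof -
  have "{x \<in> space (PiM {1..n} (\<lambda>_. borel :: real measure)). x i = x l \<longleftrightarrow> r i = r l} \<in> sets (PiM {1..n} (\<lambda>_. borel))"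
    if "i \<in> {1..n}" "l \<in> {1..n}" for i l
  proof -
    have "{x \<in> space (PiM {1..n} (\<lambda>_. borel :: real measure)). x i = x l} \<in> sets (PiM {1..n} (\<lambda>_. borel))"
      using that by (intro borel_measurable_eq measurable_component_singleton)
    then show ?thesis
      by (cases "r i = r l") (auto dest: sets.sets_Collect_neg)
  qed
  then show ?thesis
    unfolding rep_eq_reps_iff[OF r] by (intro sets.sets_Collect_finite_All) simp_all
qed

section \<open>Sigma-algebras generated by real functions\<close>

lemma space_gen_sa [simp]: "space (gen_sa M X I) = space M"
  and sets_gen_sa: "sets (gen_sa M X I) = sigma_sets (space M) {X i -` B \<inter> space M |i B. i \<in> I \<and> B \<in> sets borel}"
  unfolding gen_sa_def by (intro space_measure_of sets_measure_of; blast)+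

lemma gen_sa_measurable: "i \<in> I \<Longrightarrow> X i \<in> borel_measurable (gen_sa M X I)"
  by (rule measurableI) (auto simp: sets_gen_sa intro!: sigma_sets.Basic)

lemma sets_gen_sa_subset:
  assumes "space N = space M" "\<And>i. i \<in> I \<Longrightarrow> X i \<in> borel_measurable N"
  shows "sets (gen_sa M X I) \<subseteq> sets N"
  unfolding sets_gen_sa assms(1)[symmetric]
  by (rule sets.sigma_sets_subset) (use assms(2) in \<open>auto intro: measurable_sets\<close>)

section \<open>Mixtures over partitions\<close>

context diffuse_prob
begin

text \<open>A code \<open>r\<close> is chosen with weight \<open>c r\<close>, then its blocks are
  filled with i.i.d. values; only the coordinates at block minima are read. The weights are not
  normalised a priori.\<close>

definition rep_mixture :: "nat \<Rightarrow> ((nat \<Rightarrow> nat) \<Rightarrow> ennreal) \<Rightarrow> (nat \<Rightarrow> real) measure" where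
  "rep_mixture n c = distr (point_measure (reps n) c \<Otimes>\<^sub>M PiM {1..n} (\<lambda>_. \<nu>0)) (PiM {1..n} (\<lambda>_. borel))
    (\<lambda>(r, x). \<lambda>i\<in>{1..n}. x (r i))"

lemma nn_integral_rep_mixture:
  assumes F: "F \<in> borel_measurable (PiM {1..n} (\<lambda>_. borel))"
  shows "(\<integral>\<^sup>+x. F x \<partial>rep_mixture n c) =
    (\<Sum>r\<in>reps n. c r * (\<integral>\<^sup>+x. F (\<lambda>i\<in>{1..n}. x (r i)) \<partial>PiM {1..n} (\<lambda>_. \<nu>0)))"
proof -
  let ?P = "PiM {1..n} (\<lambda>_::nat. \<nu>0)"
  interpret Pn: prob_space ?P by (rule prob_space_PiM) (rule prob_space_axioms)
  have m0: "(\<lambda>(r, x). \<lambda>i\<in>{1..n}. x (r i)) \<in> measurable (count_space (reps n) \<Otimes>\<^sub>M ?P) (PiM {1..n} (\<lambda>_. borel))"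
  proof (rule measurable_pair_measure_countable1)
    fix r assume "r \<in> reps n"
    then show "(\<lambda>y. case (r, y) of (r, x) \<Rightarrow> \<lambda>i\<in>{1..n}. x (r i)) \<in> measurable ?P (PiM {1..n} (\<lambda>_. borel))"
      unfolding prod.case by (rule measurable_reindex)
  qed (simp add: countable_finite finite_reps)
  have m: "(\<lambda>(r, x). \<lambda>i\<in>{1..n}. x (r i)) \<in> measurable (point_measure (reps n) c \<Otimes>\<^sub>M ?P) (PiM {1..n} (\<lambda>_. borel))"
    using m0 by (subst measurable_cong_sets[OF sets_pair_measure_cong refl, of _ "count_space (reps n)" _ ?P])
      (simp_all add: sets_point_measure)
  have m2: "(\<lambda>z. F (case z of (r, x) \<Rightarrow> \<lambda>i\<in>{1..n}. x (r i))) \<in> borel_measurable (point_measure (reps n) c \<Otimes>\<^sub>M ?P)"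
    by (rule measurable_compose[OF m F])
  have "(\<integral>\<^sup>+x. F x \<partial>rep_mixture n c) =
    (\<integral>\<^sup>+z. F (case z of (r, x) \<Rightarrow> \<lambda>i\<in>{1..n}. x (r i)) \<partial>(point_measure (reps n) c \<Otimes>\<^sub>M ?P))"
    unfolding rep_mixture_def by (rule nn_integral_distr[OF m]) (use F in simp)
  also have "\<dots> = (\<integral>\<^sup>+r. \<integral>\<^sup>+x. F (\<lambda>i\<in>{1..n}. x (r i)) \<partial>?P \<partial>point_measure (reps n) c)"
    using Pn.nn_integral_fst[OF m2, symmetric] by simp
  also have "\<dots> = (\<Sum>r\<in>reps n. c r * (\<integral>\<^sup>+x. F (\<lambda>i\<in>{1..n}. x (r i)) \<partial>?P))"
    by (rule nn_integral_point_measure_finite[OF finite_reps])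
  finally show ?thesis .
qed

lemma measurable_mix_weight [measurable]:
  "(\<lambda>x. mix_weight x k) \<in> borel_measurable (PiM UNIV (\<lambda>_::nat. borel))"
  unfolding mix_weight_def by (cases k) simp_all

lemma measurable_mix_prob [measurable]:
  "A \<in> sets borel \<Longrightarrow> (\<lambda>y. mix_prob \<nu>0 A y k) \<in> borel_measurable (PiM UNIV (\<lambda>_::nat. borel))"
  unfolding mix_prob_def by (cases k) simp_all

end

section \<open>The sampling model\<close>

locale ssp_sample = prob_space M + nu: diffuse_prob \<nu>0
  for M :: "'a measure" and \<nu>0 :: "real measure" +
  fixes p eta v :: "nat \<Rightarrow> 'a \<Rightarrow> real" and \<pi> :: "nat multiset \<Rightarrow> real"
  assumes nu0_supp: "measure \<nu>0 {0..1} = 1"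
    and p_meas [measurable]: "\<And>i. p i \<in> borel_measurable M"
    and eta_meas [measurable]: "\<And>i. eta i \<in> borel_measurable M"
    and v_meas [measurable]: "\<And>i. v i \<in> borel_measurable M"
    and p_weights: "AE \<omega> in M. (\<forall>i. 0 \<le> p i \<omega>) \<and> (\<forall>n. (\<Sum>i<n. p i \<omega>) \<le> 1)"
    and eta_iid: "indep_vars (\<lambda>_. borel) eta UNIV"
    and eta_law: "\<And>i. distr M borel (eta i) = \<nu>0"
    and p_eta_indep: "indep_var
          (PiM UNIV (\<lambda>_::nat. borel)) (\<lambda>\<omega>. \<lambda>i. p i \<omega>)
          (PiM UNIV (\<lambda>_::nat. borel)) (\<lambda>\<omega>. \<lambda>i. eta i \<omega>)"
    and v_range: "\<And>i \<omega>. i \<ge> 1 \<Longrightarrow> \<omega> \<in> space M \<Longrightarrow> v i \<omega> \<in> {0..1}"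
    and v_cond_iid: "\<And>n A. (\<And>i::nat. A i \<in> sets borel) \<Longrightarrow>
          (AE \<omega> in M.
             real_cond_exp M (gen_sa M (\<lambda>A \<omega>. ssp_measure \<nu>0 p eta \<omega> A) (sets borel))
               (\<lambda>\<omega>. \<Prod>i\<in>{1..n}. indicator (A i) (v i \<omega>)) \<omega>
             = (\<Prod>i\<in>{1..n}. ssp_measure \<nu>0 p eta \<omega> (A i)))"
    and eppf: "\<And>n P. n \<ge> 1 \<Longrightarrow> partition_on {1..n} P \<Longrightarrow>
          measure M {\<omega> \<in> space M. tie_partition v n \<omega> = P} = \<pi> (block_sizes P)"
begin

definition obs :: "nat \<Rightarrow> 'a \<Rightarrow> nat \<Rightarrow> real" where
  "obs n \<omega> = (\<lambda>i\<in>{1..n}. v i \<omega>)"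

lemma obs_meas [measurable]: "obs n \<in> measurable M (PiM {1..n} (\<lambda>_. borel))"
  unfolding obs_def by measurable

lemma subalgebra_gen_sa:
  assumes "\<And>i. i \<in> I \<Longrightarrow> X i \<in> borel_measurable M"
  shows "finite_measure_subalgebra M (gen_sa M X I)"
  using sets_gen_sa_subset[of M M I X] assms
  by unfold_locales (simp add: subalgebra_def)

lemma ssp_measurable [measurable]:
  assumes A [measurable]: "A \<in> sets borel"
  shows "(\<lambda>\<omega>. ssp_measure \<nu>0 p eta \<omega> A) \<in> borel_measurable M"
  unfolding ssp_measure_def by measurable

text \<open>Bounded partial sums make the series converge, so the real-valued formula is an integral
  over the indices \<open>k\<close>, with the diffuse part as term 0. As an integral against
  counting measure it can be multiplied out by Tonelli. The quantifier over \<open>A\<close> inside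
  the almost-sure statement gives one null set for all \<open>A\<close>.\<close>

lemma AE_ssp_mixture:
  "AE \<omega> in M. \<forall>A. 0 \<le> ssp_measure \<nu>0 p eta \<omega> A \<and> ennreal (ssp_measure \<nu>0 p eta \<omega> A) =
    (\<integral>\<^sup>+k. mix_weight (\<lambda>k. p k \<omega>) k * mix_prob \<nu>0 A (\<lambda>k. eta k \<omega>) k \<partial>count_space UNIV)"
  using p_weights
proof eventually_elim
  fix \<omega> assume w: "(\<forall>i. 0 \<le> p i \<omega>) \<and> (\<forall>n. (\<Sum>i<n. p i \<omega>) \<le> 1)"
  have sp: "summable (\<lambda>k. p k \<omega>)" using w by (intro summableI_nonneg_bounded[where x = 1]) auto
  have s1: "(\<Sum>k. p k \<omega>) \<le> 1" using w sp by (intro suminf_le_const) auto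
  show "\<forall>A. 0 \<le> ssp_measure \<nu>0 p eta \<omega> A \<and> ennreal (ssp_measure \<nu>0 p eta \<omega> A) =
    (\<integral>\<^sup>+k. mix_weight (\<lambda>k. p k \<omega>) k * mix_prob \<nu>0 A (\<lambda>k. eta k \<omega>) k \<partial>count_space UNIV)"
  proof
    fix A
    define f where "f k = (case k of 0 \<Rightarrow> (1 - (\<Sum>k. p k \<omega>)) * measure \<nu>0 A | Suc k \<Rightarrow> p k \<omega> * indicator A (eta k \<omega>))" for k
    have sA: "summable (\<lambda>k. p k \<omega> * indicator A (eta k \<omega>))"
      using w by (intro summable_comparison_test'[OF sp, of 0]) (auto simp: indicator_def)
    then have sf: "summable f"
      using summable_Suc_iff[of f] by (simp add: f_def)
    have f0: "0 \<le> f k" for k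
      using w s1 by (cases k) (auto simp: f_def)
    have fs: "(\<Sum>k. f k) = ssp_measure \<nu>0 p eta \<omega> A"
    proof -
      have "(\<Sum>k. f k) = f 0 + (\<Sum>k. f (Suc k))" using suminf_split_head[OF sf] by simp
      also have "f 0 = (1 - (\<Sum>k. p k \<omega>)) * measure \<nu>0 A" by (simp add: f_def)
      also have "(\<Sum>k. f (Suc k)) = (\<Sum>k. p k \<omega> * indicator A (eta k \<omega>))" by (simp add: f_def)
      finally show ?thesis by (simp add: ssp_measure_def)
    qed
    have "mix_weight (\<lambda>k. p k \<omega>) k * mix_prob \<nu>0 A (\<lambda>k. eta k \<omega>) k = ennreal (f k)" for k
      using w s1 by (cases k) (auto simp: mix_weight_def mix_prob_def f_def nu.emeasure_eq_measure
          ennreal_mult indicator_def)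
    then have "(\<integral>\<^sup>+k. mix_weight (\<lambda>k. p k \<omega>) k * mix_prob \<nu>0 A (\<lambda>k. eta k \<omega>) k \<partial>count_space UNIV) = (\<Sum>k. ennreal (f k))"
      by (simp add: nn_integral_count_space_nat)
    also have "\<dots> = ennreal (ssp_measure \<nu>0 p eta \<omega> A)"
      using suminf_ennreal2[OF f0 sf] fs by simp
    finally show "0 \<le> ssp_measure \<nu>0 p eta \<omega> A \<and> ennreal (ssp_measure \<nu>0 p eta \<omega> A) =
      (\<integral>\<^sup>+k. mix_weight (\<lambda>k. p k \<omega>) k * mix_prob \<nu>0 A (\<lambda>k. eta k \<omega>) k \<partial>count_space UNIV)"
      using suminf_nonneg[OF sf f0] fs by simp
  qed
qed

text \<open>Expectations are taken on both sides of the conditional i.i.d. property; conditional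
  expectation preserves them.\<close>

lemma emeasure_rectangle:
  assumes A [measurable]: "\<And>i. A i \<in> sets borel"
  shows "(\<integral>\<^sup>+\<omega>. indicator (\<Pi>\<^sub>E i\<in>{1..n}. A i) (obs n \<omega>) \<partial>M) =
    (\<integral>\<^sup>+\<omega>. (\<Prod>i\<in>{1..n}. ennreal (ssp_measure \<nu>0 p eta \<omega> (A i))) \<partial>M)"
proof -
  let ?G = "gen_sa M (\<lambda>A \<omega>. ssp_measure \<nu>0 p eta \<omega> A) (sets borel)"
  let ?f = "\<lambda>\<omega>. \<Prod>i\<in>{1..n}. indicator (A i) (v i \<omega>) :: real"
  let ?g = "\<lambda>\<omega>. \<Prod>i\<in>{1..n}. ssp_measure \<nu>0 p eta \<omega> (A i)"
  interpret G: finite_measure_subalgebra M ?G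
    by (rule subalgebra_gen_sa) (erule ssp_measurable)
  have f: "integrable M ?f"
    by (rule integrable_const_bound[where B = 1]) (auto intro!: AE_I2 prod_le_1 simp: abs_prod)
  have ce: "AE \<omega> in M. real_cond_exp M ?G ?f \<omega> = ?g \<omega>"
    by (rule v_cond_iid) (rule A)
  have g: "integrable M ?g"
    using G.real_cond_exp_int(1)[OF f] by (rule integrable_cong_AE_imp) (use ce in auto)
  have "(\<integral>\<^sup>+\<omega>. indicator (\<Pi>\<^sub>E i\<in>{1..n}. A i) (obs n \<omega>) \<partial>M) = (\<integral>\<^sup>+\<omega>. ennreal (?f \<omega>) \<partial>M)"
    unfolding prod_indicator_PiE obs_def by (intro nn_integral_cong) (simp add: indicator_def)
  also have "\<dots> = ennreal (\<integral>\<omega>. ?f \<omega> \<partial>M)"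
    by (rule nn_integral_eq_integral[OF f]) (auto intro!: AE_I2 prod_nonneg)
  also have "(\<integral>\<omega>. ?f \<omega> \<partial>M) = (\<integral>\<omega>. ?g \<omega> \<partial>M)"
    unfolding G.real_cond_exp_int(2)[OF f, symmetric] by (rule integral_cong_AE) (use ce in auto)
  also have "ennreal (\<integral>\<omega>. ?g \<omega> \<partial>M) = (\<integral>\<^sup>+\<omega>. ennreal (?g \<omega>) \<partial>M)"
  proof (rule nn_integral_eq_integral[OF g, symmetric])
    show "AE \<omega> in M. 0 \<le> ?g \<omega>"
      using AE_ssp_mixture by eventually_elim (auto intro!: prod_nonneg)
  qed
  also have "\<dots> = (\<integral>\<^sup>+\<omega>. (\<Prod>i\<in>{1..n}. ennreal (ssp_measure \<nu>0 p eta \<omega> (A i))) \<partial>M)"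
  proof (rule nn_integral_cong_AE)
    show "AE \<omega> in M. ennreal (?g \<omega>) = (\<Prod>i\<in>{1..n}. ennreal (ssp_measure \<nu>0 p eta \<omega> (A i)))"
      using AE_ssp_mixture by eventually_elim (rule prod_ennreal[symmetric], blast)
  qed
  finally show ?thesis .
qed

text \<open>For a fixed index vector, the positions in \<open>I0\<close> contribute constants, while
  all positions with the same atom \<open>k\<close> impose the single condition that
  \<open>eta k\<close> lies in \<open>B k\<close>. Independence of the atoms gives one factor per
  atom. Both kinds of factor are block factors of the kernel of \<open>atom_code J\<close>: a
  singleton block for each diffuse draw, one block for each atom drawn.\<close>

lemma nn_integral_mix_prob:
  assumes A: "\<And>i. A i \<in> sets borel"
  shows "(\<integral>\<^sup>+\<omega>. (\<Prod>i\<in>{1..n}. mix_prob \<nu>0 (A i) (\<lambda>k. eta k \<omega>) (J i)) \<partial>M) =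
    (\<integral>\<^sup>+z. indicator (\<Pi>\<^sub>E i\<in>{1..n}. A i) (\<lambda>i\<in>{1..n}. z (rep n (atom_code J) i)) \<partial>PiM {1..n} (\<lambda>_. \<nu>0))"
proof -
  define I0 where "I0 = {i \<in> {1..n}. J i = 0}"
  define I1 where "I1 = {i \<in> {1..n}. J i \<noteq> 0}"
  define K where "K = (\<lambda>i. J i - 1) ` I1"
  define B where "B k = {z. \<forall>i\<in>{1..n}. J i = Suc k \<longrightarrow> z \<in> A i}" for k
  have I: "{1..n} = I0 \<union> I1" "I0 \<inter> I1 = {}" "finite I0" "finite I1" by (auto simp: I0_def I1_def)
  have K: "finite K" using I by (simp add: K_def)
  have B: "B k \<in> sets borel" for k
  proof -
    have "B k = (\<Inter>i\<in>{0..n}. if i \<in> {1..n} \<and> J i = Suc k then A i else UNIV)"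
      by (auto simp: B_def)
    also have "\<dots> \<in> sets borel" using A by (intro sets.finite_INT) auto
    finally show ?thesis .
  qed
  have law: "prob (eta k -` B k \<inter> space M) = measure \<nu>0 (B k)" for k
    using measure_distr[of "eta k" M borel "B k"] B eta_law[of k] by simp
  have meas: "(\<Inter>k\<in>K. eta k -` B k \<inter> space M) \<inter> space M \<in> sets M"
  proof -
    have "(\<Inter>k\<in>K. eta k -` B k \<inter> space M) \<inter> space M = {\<omega> \<in> space M. \<forall>k\<in>K. \<omega> \<in> eta k -` B k \<inter> space M}" by auto
    also have "\<dots> \<in> sets M" using B K by (intro sets.sets_Collect_finite_All) (auto intro: measurable_sets)
    finally show ?thesis .
  qed
  have "(\<Prod>i\<in>I1. mix_prob \<nu>0 (A i) (\<lambda>k. eta k \<omega>) (J i)) = indicator ((\<Inter>k\<in>K. eta k -` B k \<inter> space M) \<inter> space M) \<omega>"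
    if \<omega>: "\<omega> \<in> space M" for \<omega>
  proof (cases "\<forall>i\<in>I1. eta (J i - 1) \<omega> \<in> A i")
    case True
    then have "eta k \<omega> \<in> B k" for k
      by (fastforce simp: B_def I1_def)
    then have "\<omega> \<in> (\<Inter>k\<in>K. eta k -` B k \<inter> space M) \<inter> space M" using \<omega> by simp
    moreover have "mix_prob \<nu>0 (A i) (\<lambda>k. eta k \<omega>) (J i) = 1" if "i \<in> I1" for i
      using True that by (cases "J i") (auto simp: mix_prob_def I1_def dest!: bspec[of _ _ i])
    ultimately show ?thesis by simp
  next
    case False
    then obtain i where i: "i \<in> I1" "eta (J i - 1) \<omega> \<notin> A i" by blast
    then obtain k where k: "J i = Suc k" by (cases "J i") (auto simp: I1_def)
    then have "eta k \<omega> \<notin> B k" "k \<in> K" using i by (force simp: B_def K_def I1_def)+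
    then have notin: "\<omega> \<notin> (\<Inter>k\<in>K. eta k -` B k \<inter> space M) \<inter> space M" by blast
    have "mix_prob \<nu>0 (A i) (\<lambda>k. eta k \<omega>) (J i) = 0" using i k by (simp add: mix_prob_def)
    then have "(\<Prod>i\<in>I1. mix_prob \<nu>0 (A i) (\<lambda>k. eta k \<omega>) (J i)) = 0"
      using i(1) by (intro prod_zero[OF I(4)]) blast
    then show ?thesis unfolding indicator_simps(2)[OF notin] .
  qed
  then have "(\<integral>\<^sup>+\<omega>. (\<Prod>i\<in>{1..n}. mix_prob \<nu>0 (A i) (\<lambda>k. eta k \<omega>) (J i)) \<partial>M) =
    (\<integral>\<^sup>+\<omega>. (\<Prod>i\<in>I0. emeasure \<nu>0 (A i)) * indicator ((\<Inter>k\<in>K. eta k -` B k \<inter> space M) \<inter> space M) \<omega> \<partial>M)"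
    unfolding I(1) by (intro nn_integral_cong, subst prod.union_disjoint[OF I(3,4,2)]) (simp add: mix_prob_def I0_def)
  also have "\<dots> = (\<Prod>i\<in>I0. emeasure \<nu>0 (A i)) * emeasure M ((\<Inter>k\<in>K. eta k -` B k \<inter> space M) \<inter> space M)"
    by (rule nn_integral_cmult_indicator[OF meas])
  also have "emeasure M ((\<Inter>k\<in>K. eta k -` B k \<inter> space M) \<inter> space M) = (\<Prod>k\<in>K. emeasure \<nu>0 (B k))"
  \<comment> \<open>The independence rule asks for a nonempty index set. For empty \<open>K\<close>
    the intersection over \<open>K\<close> is \<open>UNIV\<close>, which is why
    \<open>space M\<close> is intersected on the outside.\<close>
  proof (cases "K = {}")
    case True then show ?thesis by (simp add: emeasure_space_1)
  next
    case False
    then have "(\<Inter>k\<in>K. eta k -` B k \<inter> space M) \<inter> space M = (\<Inter>k\<in>K. eta k -` B k \<inter> space M)" by auto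
    moreover have "prob (\<Inter>k\<in>K. eta k -` B k \<inter> space M) = (\<Prod>k\<in>K. measure \<nu>0 (B k))"
      using indep_varsD[OF eta_iid False K, of B] B law by simp
    ultimately show ?thesis
      by (simp add: emeasure_eq_measure nu.emeasure_eq_measure prod_ennreal)
  qed
  also have "(\<Prod>i\<in>I0. emeasure \<nu>0 (A i)) * (\<Prod>k\<in>K. emeasure \<nu>0 (B k)) =
    (\<Prod>y\<in>atom_code J ` {1..n}. emeasure \<nu>0 {z. \<forall>i\<in>{1..n}. atom_code J i = y \<longrightarrow> z \<in> A i})" (is "_ = (\<Prod>y\<in>_. ?e y)")
  proof -
    have im: "atom_code J ` {1..n} = (\<lambda>i. (0, i)) ` I0 \<union> (\<lambda>k. (Suc k, 0)) ` K"
      unfolding I(1) image_Un K_def image_image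
      by (intro arg_cong2[where f = "(\<union>)"] image_cong) (auto simp: atom_code_def I0_def I1_def)
    have "{z. \<forall>l\<in>{1..n}. atom_code J l = (0, i) \<longrightarrow> z \<in> A l} = A i" if "i \<in> I0" for i
      using that by (auto simp: atom_code_def I0_def)
    then have e0: "?e (0, i) = emeasure \<nu>0 (A i)" if "i \<in> I0" for i using that by simp
    have "{z. \<forall>l\<in>{1..n}. atom_code J l = (Suc k, 0) \<longrightarrow> z \<in> A l} = B k" for k
      by (auto simp: atom_code_def B_def)
    then have e1: "?e (Suc k, 0) = emeasure \<nu>0 (B k)" for k by simp
    have "(\<Prod>y\<in>atom_code J ` {1..n}. ?e y) = (\<Prod>y\<in>(\<lambda>i. (0, i)) ` I0. ?e y) * (\<Prod>y\<in>(\<lambda>k. (Suc k, 0)) ` K. ?e y)"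
      unfolding im using I K by (intro prod.union_disjoint) auto
    also have "(\<Prod>y\<in>(\<lambda>i. (0, i)) ` I0. ?e y) = (\<Prod>i\<in>I0. emeasure \<nu>0 (A i))"
      by (subst prod.reindex) (simp add: inj_on_def, rule prod.cong[OF refl], simp only: comp_def e0)
    also have "(\<Prod>y\<in>(\<lambda>k. (Suc k, 0)) ` K. ?e y) = (\<Prod>k\<in>K. emeasure \<nu>0 (B k))"
      by (subst prod.reindex) (simp add: inj_on_def, rule prod.cong[OF refl], simp only: comp_def e1)
    finally show ?thesis by simp
  qed
  also have "\<dots> = (\<integral>\<^sup>+z. indicator (\<Pi>\<^sub>E i\<in>{1..n}. A i) (\<lambda>i\<in>{1..n}. z (rep n (atom_code J) i)) \<partial>PiM {1..n} (\<lambda>_. \<nu>0))"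
    by (rule nu.nn_integral_indicator_rep[OF A, symmetric])
  finally show ?thesis .
qed

end

lemma nn_integral_distr_meas:
  assumes "T \<in> measurable M N" "f \<in> borel_measurable N"
  shows "(\<integral>\<^sup>+y. f y \<partial>distr M N T) = (\<integral>\<^sup>+x. f (T x) \<partial>M)"
  using assms by (simp add: nn_integral_distr)

lemma emeasure_distr_indicator:
  assumes T: "T \<in> measurable M N" and A: "A \<in> sets N"
  shows "emeasure (distr M N T) A = (\<integral>\<^sup>+x. indicator A (T x) \<partial>M)"
  using nn_integral_distr_meas[OF T borel_measurable_indicator[OF A]] A by simp

text \<open>Boxes form an intersection-stable generator of the product sigma-algebra, and the whole
  space is a box of finite measure.\<close>

lemma measure_eqI_rectangles:
  fixes P Q :: "('i \<Rightarrow> real) measure"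
  assumes "finite I" "prob_space P" "sets P = sets (PiM I (\<lambda>_. borel))" "sets Q = sets (PiM I (\<lambda>_. borel))"
    and eq: "\<And>A. (\<And>i. A i \<in> sets borel) \<Longrightarrow> emeasure P (Pi\<^sub>E I A) = emeasure Q (Pi\<^sub>E I A)"
  shows "P = Q"
proof (rule measure_eqI_PiM_finite[where I = I and M = "\<lambda>_. borel" and A = "\<lambda>_. \<Pi>\<^sub>E i\<in>I. UNIV"])
  show "emeasure P (Pi\<^sub>E I A) = emeasure Q (Pi\<^sub>E I A)" if "\<And>i. i \<in> I \<Longrightarrow> A i \<in> sets borel" for A
  proof -
    have "Pi\<^sub>E I A = (\<Pi>\<^sub>E i\<in>I. if i \<in> I then A i else UNIV)" by (rule PiE_cong) simp
    then show ?thesis using that eq[of "\<lambda>i. if i \<in> I then A i else UNIV"] by simp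
  qed
  show "range (\<lambda>_::nat. \<Pi>\<^sub>E i\<in>I. UNIV) \<subseteq> prod_algebra I (\<lambda>_. borel :: real measure)"
    using assms(1) by (auto intro!: prod_algebraI_finite)
  show "emeasure P (\<Pi>\<^sub>E i\<in>I. UNIV) \<noteq> \<infinity>"
    using prob_space.finite_measure[OF assms(2)] by (simp add: finite_measure.emeasure_finite)
qed (use assms in \<open>simp_all add: space_PiM\<close>)

context ssp_sample
begin

text \<open>By \<open>measure_eqI_rectangles\<close> boxes suffice. There the product of the
  mixtures is expanded over index vectors \<open>J\<close>, the weights are separated from the
  atoms, and the terms are grouped by the kernel of \<open>atom_code J\<close>.\<close>

lemma distr_obs_mixture:
  obtains c where "distr M (PiM {1..n} (\<lambda>_. borel)) (obs n) = nu.rep_mixture n c"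
proof -
  let ?C = "PiM {1..n} (\<lambda>_::nat. count_space (UNIV :: nat set))"
  let ?B = "PiM {1..n} (\<lambda>_::nat. borel :: real measure)"
  let ?P = "PiM {1..n} (\<lambda>_::nat. \<nu>0)"
  let ?q = "\<lambda>\<omega> J. \<Prod>i\<in>{1..n}. mix_weight (\<lambda>k. p k \<omega>) (J i)"
  \<comment> \<open>The coefficient of \<open>r\<close> is the expected total weight of the index
    vectors whose code has kernel \<open>r\<close>.\<close>
  define c where "c r = (\<integral>\<^sup>+J. (\<integral>\<^sup>+\<omega>. ?q \<omega> J \<partial>M) * indicator {J. rep n (atom_code J) = r} J \<partial>?C)" for r
  interpret C: product_sigma_finite "\<lambda>_::nat. count_space (UNIV :: nat set)"
    unfolding product_sigma_finite_def by (simp add: sigma_finite_measure_count_space)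
  interpret C': sigma_finite_measure ?C by (rule C.sigma_finite) simp
  interpret MC: pair_sigma_finite ?C M ..
  have rect: "emeasure (distr M ?B (obs n)) (Pi\<^sub>E {1..n} A) = emeasure (nu.rep_mixture n c) (Pi\<^sub>E {1..n} A)"
    if A [measurable]: "\<And>i. A i \<in> sets borel" for A
  proof -
    have AB: "Pi\<^sub>E {1..n} A \<in> sets ?B" by (rule sets_PiM_I_finite) (simp_all add: A)
    let ?h = "\<lambda>\<omega> J. \<Prod>i\<in>{1..n}. mix_prob \<nu>0 (A i) (\<lambda>k. eta k \<omega>) (J i)"
    let ?\<Lambda> = "\<lambda>r. \<integral>\<^sup>+z. indicator (Pi\<^sub>E {1..n} A) (\<lambda>i\<in>{1..n}. z (r i)) \<partial>?P"
    have pm [measurable]: "(\<lambda>\<omega>. \<lambda>i. p i \<omega>) \<in> measurable M (PiM UNIV (\<lambda>_::nat. borel))"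
      "(\<lambda>\<omega>. \<lambda>i. eta i \<omega>) \<in> measurable M (PiM UNIV (\<lambda>_::nat. borel))"
      by (auto intro!: measurable_PiM_single' simp: space_PiM)
    have wm: "(\<lambda>\<omega>. mix_weight (\<lambda>k. p k \<omega>) k) \<in> borel_measurable M" for k
      using measurable_compose[OF pm(1) nu.measurable_mix_weight] .
    have hm: "(\<lambda>\<omega>. mix_prob \<nu>0 (A i) (\<lambda>k. eta k \<omega>) k) \<in> borel_measurable M" for i k
      using measurable_compose[OF pm(2) nu.measurable_mix_prob[OF A]] .
    \<comment> \<open>The index \<open>fst z i\<close> takes countably many values, so measurability
      for each fixed index is enough.\<close>
    have joint: "(\<lambda>z. mix_weight (\<lambda>k. p k (snd z)) (fst z i) * mix_prob \<nu>0 (A i) (\<lambda>k. eta k (snd z)) (fst z i))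
      \<in> borel_measurable (?C \<Otimes>\<^sub>M M)" if "i \<in> {1..n}" for i
    proof (rule measurable_compose_countable[where f = "\<lambda>k z. mix_weight (\<lambda>k. p k (snd z)) k * mix_prob \<nu>0 (A i) (\<lambda>k. eta k (snd z)) k" and g = "\<lambda>z. fst z i"])
      show "(\<lambda>z. mix_weight (\<lambda>k. p k (snd z)) k * mix_prob \<nu>0 (A i) (\<lambda>k. eta k (snd z)) k)
        \<in> borel_measurable (?C \<Otimes>\<^sub>M M)" for k
        by (intro borel_measurable_times_ennreal measurable_compose[OF measurable_snd wm] measurable_compose[OF measurable_snd hm])
      show "(\<lambda>z. fst z i) \<in> measurable (?C \<Otimes>\<^sub>M M) (count_space UNIV)"
        using that by (intro measurable_compose[OF measurable_fst measurable_component_singleton])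
    qed
    have "emeasure (distr M ?B (obs n)) (Pi\<^sub>E {1..n} A) = (\<integral>\<^sup>+\<omega>. indicator (Pi\<^sub>E {1..n} A) (obs n \<omega>) \<partial>M)"
      by (rule emeasure_distr_indicator[OF obs_meas AB])
    also have "\<dots> = (\<integral>\<^sup>+\<omega>. (\<Prod>i\<in>{1..n}. ennreal (ssp_measure \<nu>0 p eta \<omega> (A i))) \<partial>M)"
      by (rule emeasure_rectangle[OF A])
    also have "\<dots> = (\<integral>\<^sup>+\<omega>. (\<Prod>i\<in>{1..n}. \<integral>\<^sup>+k. mix_weight (\<lambda>k. p k \<omega>) k * mix_prob \<nu>0 (A i) (\<lambda>k. eta k \<omega>) k \<partial>count_space UNIV) \<partial>M)"
      by (rule nn_integral_cong_AE) (use AE_ssp_mixture in eventually_elim, simp)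
    also have "\<dots> = (\<integral>\<^sup>+\<omega>. \<integral>\<^sup>+J. (\<Prod>i\<in>{1..n}. mix_weight (\<lambda>k. p k \<omega>) (J i) * mix_prob \<nu>0 (A i) (\<lambda>k. eta k \<omega>) (J i)) \<partial>?C \<partial>M)"
      by (intro nn_integral_cong C.product_nn_integral_prod[symmetric]) simp_all
    also have "\<dots> = (\<integral>\<^sup>+J. \<integral>\<^sup>+\<omega>. (\<Prod>i\<in>{1..n}. mix_weight (\<lambda>k. p k \<omega>) (J i) * mix_prob \<nu>0 (A i) (\<lambda>k. eta k \<omega>) (J i)) \<partial>M \<partial>?C)"
      using MC.Fubini[of "\<lambda>z. \<Prod>i\<in>{1..n}. mix_weight (\<lambda>k. p k (snd z)) (fst z i) * mix_prob \<nu>0 (A i) (\<lambda>k. eta k (snd z)) (fst z i)"]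
        joint by (simp add: borel_measurable_prod_ennreal)
    also have "\<dots> = (\<integral>\<^sup>+J. (\<integral>\<^sup>+\<omega>. ?q \<omega> J \<partial>M) * ?\<Lambda> (rep n (atom_code J)) \<partial>?C)"
    proof (rule nn_integral_cong)
      fix J
      have "(\<integral>\<^sup>+\<omega>. (\<Prod>i\<in>{1..n}. mix_weight (\<lambda>k. p k \<omega>) (J i) * mix_prob \<nu>0 (A i) (\<lambda>k. eta k \<omega>) (J i)) \<partial>M)
        = (\<integral>\<^sup>+\<omega>. ?q \<omega> J * ?h \<omega> J \<partial>M)"
        by (simp add: prod.distrib)
      also have "\<dots> = (\<integral>\<^sup>+\<omega>. ?q \<omega> J \<partial>M) * (\<integral>\<^sup>+\<omega>. ?h \<omega> J \<partial>M)"
        by (rule indep_var_nn_integral_mult[OF p_eta_indep,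
            of "\<lambda>x. \<Prod>i\<in>{1..n}. mix_weight x (J i)" "\<lambda>y. \<Prod>i\<in>{1..n}. mix_prob \<nu>0 (A i) y (J i)"])
          (intro borel_measurable_prod_ennreal nu.measurable_mix_weight nu.measurable_mix_prob A)+
      also have "(\<integral>\<^sup>+\<omega>. ?h \<omega> J \<partial>M) = ?\<Lambda> (rep n (atom_code J))"
        by (rule nn_integral_mix_prob[OF A])
      finally show "(\<integral>\<^sup>+\<omega>. (\<Prod>i\<in>{1..n}. mix_weight (\<lambda>k. p k \<omega>) (J i) * mix_prob \<nu>0 (A i) (\<lambda>k. eta k \<omega>) (J i)) \<partial>M)
        = (\<integral>\<^sup>+\<omega>. ?q \<omega> J \<partial>M) * ?\<Lambda> (rep n (atom_code J))" .
    qed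
    \<comment> \<open>Exactly one summand survives, the one for the kernel of
      \<open>atom_code J\<close>; this is the grouping.\<close>
    also have "\<dots> = (\<integral>\<^sup>+J. (\<Sum>r\<in>reps n. (\<integral>\<^sup>+\<omega>. ?q \<omega> J \<partial>M) * indicator {J. rep n (atom_code J) = r} J * ?\<Lambda> r) \<partial>?C)"
    proof (rule nn_integral_cong)
      fix J
      have "(\<Sum>r\<in>reps n. (\<integral>\<^sup>+\<omega>. ?q \<omega> J \<partial>M) * indicator {J. rep n (atom_code J) = r} J * ?\<Lambda> r)
        = (\<Sum>r\<in>{rep n (atom_code J)}. (\<integral>\<^sup>+\<omega>. ?q \<omega> J \<partial>M) * indicator {J. rep n (atom_code J) = r} J * ?\<Lambda> r)"
        by (rule sum.mono_neutral_right) (auto simp: finite_reps rep_in_reps)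
      then show "(\<integral>\<^sup>+\<omega>. ?q \<omega> J \<partial>M) * ?\<Lambda> (rep n (atom_code J)) =
        (\<Sum>r\<in>reps n. (\<integral>\<^sup>+\<omega>. ?q \<omega> J \<partial>M) * indicator {J. rep n (atom_code J) = r} J * ?\<Lambda> r)"
        by simp
    qed
    also have "\<dots> = (\<Sum>r\<in>reps n. c r * ?\<Lambda> r)"
      unfolding c_def
      by (subst nn_integral_sum[OF borel_measurable_PiM_count_space])
        (intro sum.cong refl nn_integral_multc borel_measurable_PiM_count_space)
    also have "\<dots> = (\<integral>\<^sup>+x. indicator (Pi\<^sub>E {1..n} A) x \<partial>nu.rep_mixture n c)"
      using AB by (subst nu.nn_integral_rep_mixture) simp_all
    also have "\<dots> = emeasure (nu.rep_mixture n c) (Pi\<^sub>E {1..n} A)"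
      using AB by (intro nn_integral_indicator) (simp add: nu.rep_mixture_def)
    finally show ?thesis .
  qed
  have "distr M ?B (obs n) = nu.rep_mixture n c"
    by (rule measure_eqI_rectangles[OF finite_atLeastAtMost prob_space_distr[OF obs_meas] _ _ rect])
      (simp_all add: nu.rep_mixture_def)
  then show ?thesis by (rule that)
qed

section \<open>Mixing coefficients as EPPF values\<close>

lemma tie_partition_eq:
  "tie_partition v n \<omega> = (\<lambda>i. {l \<in> {1..n}. r l = r i}) ` {1..n} \<longleftrightarrow>
    rep n (\<lambda>i. v i \<omega>) = rep n r"
  unfolding tie_partition_def classes_eq_iff[of n "\<lambda>i. v i \<omega>" r] rep_cong_iff ..

lemma rep_obs: "rep n (obs n \<omega>) = rep n (\<lambda>i. v i \<omega>)"
  unfolding rep_cong_iff by (simp add: obs_def)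

lemma sets_rep_v:
  assumes r: "r \<in> reps n"
  shows "{\<omega> \<in> space M. rep n (\<lambda>i. v i \<omega>) = r} \<in> sets M"
proof -
  let ?S = "{x \<in> space (PiM {1..n} (\<lambda>_. borel :: real measure)). rep n x = r}"
  have "obs n -` ?S \<inter> space M = {\<omega> \<in> space M. rep n (\<lambda>i. v i \<omega>) = r}"
    using measurable_space[OF obs_meas] by (auto simp: rep_obs)
  then show ?thesis using measurable_sets[OF obs_meas sets_rep_eq[OF r]] by simp
qed

text \<open>The classes of the code \<open>r\<close> form a partition to which \<open>eppf\<close>
  applies, and the tie partition equals it iff the observations have kernel
  \<open>r\<close>.\<close>

lemma emeasure_rep:
  assumes "n \<ge> 1" "r \<in> reps n"
  shows "emeasure M {\<omega> \<in> space M. rep n (\<lambda>i. v i \<omega>) = r} = ennreal (\<pi> (bsizes n r))"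
    and "0 \<le> \<pi> (bsizes n r)"
proof -
  have r: "rep n r = r" using assms by (simp add: reps_def)
  have eq: "measure M {\<omega> \<in> space M. rep n (\<lambda>i. v i \<omega>) = r} = \<pi> (bsizes n r)"
    using eppf[OF assms(1) partition_on_classes[of n r]]
    unfolding tie_partition_eq r block_sizes_classes .
  then show "emeasure M {\<omega> \<in> space M. rep n (\<lambda>i. v i \<omega>) = r} = ennreal (\<pi> (bsizes n r))"
    by (simp add: emeasure_eq_measure)
  show "0 \<le> \<pi> (bsizes n r)" unfolding eq[symmetric] by simp
qed

text \<open>The coefficients are identified by testing the mixture on the event that the kernel is
  \<open>r\<close>: the component with code \<open>r'\<close> almost surely has kernel
  \<open>r'\<close>, so the event has mass \<open>c r\<close>, whereas by
  \<open>emeasure_rep\<close> it has the EPPF value as its mass.\<close>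

lemma nn_integral_obs:
  assumes n: "n \<ge> 1" and F: "F \<in> borel_measurable (PiM {1..n} (\<lambda>_. borel))"
  shows "(\<integral>\<^sup>+\<omega>. F (obs n \<omega>) \<partial>M) =
    (\<Sum>r\<in>reps n. ennreal (\<pi> (bsizes n r)) * (\<integral>\<^sup>+x. F (\<lambda>i\<in>{1..n}. x (r i)) \<partial>PiM {1..n} (\<lambda>_. \<nu>0)))"
proof -
  let ?P = "PiM {1..n} (\<lambda>_::nat. \<nu>0)"
  let ?B = "PiM {1..n} (\<lambda>_::nat. borel :: real measure)"
  interpret Pn: prob_space ?P by (rule prob_space_PiM) (rule nu.prob_space_axioms)
  obtain c where c: "distr M ?B (obs n) = nu.rep_mixture n c" by (rule distr_obs_mixture)
  have law: "(\<integral>\<^sup>+\<omega>. F (obs n \<omega>) \<partial>M) = (\<Sum>r\<in>reps n. c r * (\<integral>\<^sup>+x. F (\<lambda>i\<in>{1..n}. x (r i)) \<partial>?P))"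
    if F: "F \<in> borel_measurable ?B" for F
  proof -
    have "(\<integral>\<^sup>+\<omega>. F (obs n \<omega>) \<partial>M) = (\<integral>\<^sup>+x. F x \<partial>distr M ?B (obs n))"
      by (rule nn_integral_distr_meas[OF obs_meas F, symmetric])
    then show ?thesis unfolding c nu.nn_integral_rep_mixture[OF F] .
  qed
  have "c r = ennreal (\<pi> (bsizes n r))" if r: "r \<in> reps n" for r
  proof -
    have meas: "(\<lambda>x. indicator {x. rep n x = r} x :: ennreal) \<in> borel_measurable ?B"
      by (rule borel_measurable_indicator_pred[OF sets_rep_eq[OF r]])
    have int: "(\<integral>\<^sup>+x. indicator {x. rep n x = r} (\<lambda>i\<in>{1..n}. x (r' i)) \<partial>?P) = indicator {r} r'" if r': "r' \<in> reps n" for r'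
    proof -
      have "(\<integral>\<^sup>+x. indicator {x. rep n x = r} (\<lambda>i\<in>{1..n}. x (r' i)) \<partial>?P) = (\<integral>\<^sup>+x. indicator {r} r' \<partial>?P)"
      proof (rule nn_integral_cong_AE)
        show "AE x in ?P. (indicator {x. rep n x = r} (\<lambda>i\<in>{1..n}. x (r' i)) :: ennreal) = indicator {r} r'"
          using nu.AE_PiM_inj_on[of "{1..n}", OF finite_atLeastAtMost]
        proof eventually_elim
          fix x :: "nat \<Rightarrow> real" assume "inj_on x {1..n}"
          then have "rep n (\<lambda>i\<in>{1..n}. x (r' i)) = r'" by (rule rep_inj_comp[OF r'])
          then show "(indicator {x. rep n x = r} (\<lambda>i\<in>{1..n}. x (r' i)) :: ennreal) = indicator {r} r'"
            by (simp add: indicator_def)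
        qed
      qed
      then show ?thesis by (simp add: Pn.emeasure_space_1 del: One_nat_def)
    qed
    have "{\<omega> \<in> space M. rep n (\<lambda>i. v i \<omega>) = r} \<in> sets M" by (rule sets_rep_v[OF r])
    then have "ennreal (\<pi> (bsizes n r)) = (\<integral>\<^sup>+\<omega>. indicator {\<omega>. rep n (\<lambda>i. v i \<omega>) = r} \<omega> \<partial>M)"
      using emeasure_eq_nn_integral_Collect emeasure_rep(1)[OF n r] by metis
    also have "\<dots> = (\<integral>\<^sup>+\<omega>. indicator {x. rep n x = r} (obs n \<omega>) \<partial>M)"
      by (simp add: rep_obs indicator_def)
    also have "\<dots> = (\<Sum>r'\<in>reps n. c r' * indicator {r} r')"
      unfolding law[OF meas] by (intro sum.cong refl arg_cong2[where f = "(*)"] int)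
    also have "\<dots> = (\<Sum>r'\<in>{r}. c r' * indicator {r} r')"
      using r by (intro sum.mono_neutral_right finite_reps) auto
    finally show ?thesis by simp
  qed
  then show ?thesis unfolding law[OF F] by (intro sum.cong) simp_all
qed

end

section \<open>The prediction rule\<close>

lemma bsizes_cong:
  "rep n x = rep n y \<Longrightarrow> bsizes n x = bsizes n y"
  unfolding block_sizes_classes[symmetric] rep_cong_iff classes_eq_iff[symmetric] by simp

section \<open>Stationarity of the sample\<close>

context ssp_sample
begin

definition shift_obs :: "nat \<Rightarrow> nat \<Rightarrow> 'a \<Rightarrow> nat \<Rightarrow> real" where
  "shift_obs k n \<omega> = (\<lambda>i\<in>{1..n}. v (k + i) \<omega>)"

lemma shift_obs_meas [measurable]: "shift_obs k n \<in> measurable M (PiM {1..n} (\<lambda>_. borel))"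
  unfolding shift_obs_def by measurable

text \<open>The sum of the weights occurs twice with opposite signs and cancels at every sample
  point.\<close>

lemma ssp_UNIV: "ssp_measure \<nu>0 p eta \<omega> UNIV = 1"
  using nu.prob_space by (simp add: ssp_measure_def)

text \<open>A box condition on the window after the first \<open>k\<close> observations is a box
  condition on \<open>k + n\<close> observations whose first \<open>k\<close> sides are
  \<open>UNIV\<close>. Those factors are 1 by \<open>ssp_UNIV\<close>, and what remains is the
  formula for the first \<open>n\<close> observations.\<close>

lemma distr_shift_obs:
  "distr M (PiM {1..n} (\<lambda>_. borel)) (shift_obs k n) = distr M (PiM {1..n} (\<lambda>_. borel)) (obs n)"
proof -
  let ?B = "PiM {1..n} (\<lambda>_::nat. borel :: real measure)"
  have rect: "emeasure (distr M ?B (shift_obs k n)) (Pi\<^sub>E {1..n} A) = emeasure (distr M ?B (obs n)) (Pi\<^sub>E {1..n} A)"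
    if A: "\<And>i. A i \<in> sets borel" for A
  proof -
    define A' where "A' l = (if l \<le> k then UNIV else A (l - k))" for l
    have A': "A' l \<in> sets borel" for l using A by (simp add: A'_def)
    have AB: "Pi\<^sub>E {1..n} A \<in> sets ?B" by (rule sets_PiM_I_finite) (simp_all add: A)
    have ind: "emeasure (distr M ?B f) (Pi\<^sub>E {1..n} A) = (\<integral>\<^sup>+\<omega>. indicator (Pi\<^sub>E {1..n} A) (f \<omega>) \<partial>M)"
      if "f \<in> measurable M ?B" for f
      by (rule emeasure_distr_indicator[OF that AB])
    have "(\<integral>\<^sup>+\<omega>. indicator (Pi\<^sub>E {1..n} A) (shift_obs k n \<omega>) \<partial>M) = (\<integral>\<^sup>+\<omega>. indicator (Pi\<^sub>E {1..k + n} A') (obs (k + n) \<omega>) \<partial>M)"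
    proof (rule nn_integral_cong)
      fix \<omega>
      have "(\<forall>i\<in>{1..n}. v (k + i) \<omega> \<in> A i) \<longleftrightarrow> (\<forall>l\<in>{1..k + n}. v l \<omega> \<in> A' l)"
      proof (intro iffI ballI)
        fix l assume *: "\<forall>i\<in>{1..n}. v (k + i) \<omega> \<in> A i" and l: "l \<in> {1..k + n}"
        show "v l \<omega> \<in> A' l"
        proof (cases "l \<le> k")
          case False
          then have "v (k + (l - k)) \<omega> \<in> A (l - k)" using l by (intro *[rule_format]) auto
          then show ?thesis using False by (simp add: A'_def)
        qed (simp add: A'_def)
      next
        fix i assume *: "\<forall>l\<in>{1..k + n}. v l \<omega> \<in> A' l" and i: "i \<in> {1..n}"
        have "v (k + i) \<omega> \<in> A' (k + i)" using i by (intro *[rule_format]) auto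
        then show "v (k + i) \<omega> \<in> A i" using i by (simp add: A'_def)
      qed
      then show "(indicator (Pi\<^sub>E {1..n} A) (shift_obs k n \<omega>) :: ennreal) = indicator (Pi\<^sub>E {1..k + n} A') (obs (k + n) \<omega>)"
        by (simp add: shift_obs_def obs_def PiE_iff indicator_def)
    qed
    also have "\<dots> = (\<integral>\<^sup>+\<omega>. (\<Prod>i\<in>{1..k + n}. ennreal (ssp_measure \<nu>0 p eta \<omega> (A' i))) \<partial>M)"
      by (rule emeasure_rectangle[OF A'])
    also have "\<dots> = (\<integral>\<^sup>+\<omega>. (\<Prod>i\<in>{1..n}. ennreal (ssp_measure \<nu>0 p eta \<omega> (A i))) \<partial>M)"
    proof (rule nn_integral_cong)
      fix \<omega>
      have "(\<Prod>i\<in>{1..k + n}. ennreal (ssp_measure \<nu>0 p eta \<omega> (A' i))) = (\<Prod>i\<in>{1 + k..n + k}. ennreal (ssp_measure \<nu>0 p eta \<omega> (A' i)))"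
        by (rule prod.mono_neutral_right) (auto simp: A'_def ssp_UNIV)
      also have "\<dots> = (\<Prod>i\<in>{1..n}. ennreal (ssp_measure \<nu>0 p eta \<omega> (A' (i + k))))"
        by (rule prod.shift_bounds_cl_nat_ivl)
      also have "\<dots> = (\<Prod>i\<in>{1..n}. ennreal (ssp_measure \<nu>0 p eta \<omega> (A i)))"
        by (rule prod.cong) (auto simp: A'_def)
      finally show "(\<Prod>i\<in>{1..k + n}. ennreal (ssp_measure \<nu>0 p eta \<omega> (A' i))) = (\<Prod>i\<in>{1..n}. ennreal (ssp_measure \<nu>0 p eta \<omega> (A i)))" .
    qed
    also have "\<dots> = (\<integral>\<^sup>+\<omega>. indicator (Pi\<^sub>E {1..n} A) (obs n \<omega>) \<partial>M)"
      by (rule emeasure_rectangle[OF A, symmetric])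
    finally show ?thesis unfolding ind[OF shift_obs_meas] ind[OF obs_meas] .
  qed
  show ?thesis
    by (rule measure_eqI_rectangles[OF finite_atLeastAtMost prob_space_distr[OF shift_obs_meas] _ _ rect]) simp_all
qed

lemma nn_integral_shift_obs:
  assumes "F \<in> borel_measurable (PiM {1..n} (\<lambda>_. borel))"
  shows "(\<integral>\<^sup>+\<omega>. F (shift_obs k n \<omega>) \<partial>M) = (\<integral>\<^sup>+\<omega>. F (obs n \<omega>) \<partial>M)"
  unfolding nn_integral_distr_meas[OF shift_obs_meas assms, symmetric]
    nn_integral_distr_meas[OF obs_meas assms, symmetric] distr_shift_obs ..

section \<open>Law of one further observation\<close>

abbreviation ext_size :: "nat \<Rightarrow> (nat \<Rightarrow> nat) \<Rightarrow> nat \<Rightarrow> nat multiset" where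
  "ext_size j r b \<equiv> bsizes (Suc j) (r(Suc j := b))"

lemma measurable_reindexed:
  assumes G: "case_prod G \<in> borel_measurable (PiM {1..j} (\<lambda>_. borel) \<Otimes>\<^sub>M borel)"
    and r: "r \<in> reps j" and b: "b \<in> {1..j}"
  shows "(\<lambda>x. G (\<lambda>i\<in>{1..j}. x (r i)) (x b)) \<in> borel_measurable (PiM {1..j} (\<lambda>_. \<nu>0))"
    and "(\<lambda>x. \<integral>\<^sup>+y. G (\<lambda>i\<in>{1..j}. x (r i)) y \<partial>\<nu>0) \<in> borel_measurable (PiM {1..j} (\<lambda>_. \<nu>0))"
proof -
  have xb: "(\<lambda>x. x b) \<in> measurable (PiM {1..j} (\<lambda>_. \<nu>0)) borel"
    using b by (simp add: measurable_cong_sets[OF nu.sets_PiM_nu0 refl])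
  have "(\<lambda>x. case_prod G (\<lambda>i\<in>{1..j}. x (r i), x b)) \<in> borel_measurable (PiM {1..j} (\<lambda>_. \<nu>0))"
    by (rule measurable_compose[OF measurable_Pair[OF nu.measurable_reindex[OF r] xb] G])
  then show "(\<lambda>x. G (\<lambda>i\<in>{1..j}. x (r i)) (x b)) \<in> borel_measurable (PiM {1..j} (\<lambda>_. \<nu>0))" by simp
  have "case_prod G \<in> borel_measurable (PiM {1..j} (\<lambda>_. borel) \<Otimes>\<^sub>M \<nu>0)"
    using G by (simp add: measurable_cong_sets[OF sets_pair_measure_cong[OF refl nu.sets_nu0] refl])
  then have "(\<lambda>x. \<integral>\<^sup>+y. G x y \<partial>\<nu>0) \<in> borel_measurable (PiM {1..j} (\<lambda>_. borel))"
    by (rule nu.borel_measurable_nn_integral)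
  then show "(\<lambda>x. \<integral>\<^sup>+y. G (\<lambda>i\<in>{1..j}. x (r i)) y \<partial>\<nu>0) \<in> borel_measurable (PiM {1..j} (\<lambda>_. \<nu>0))"
    by (rule measurable_compose[OF nu.measurable_reindex[OF r]])
qed

text \<open>The mixture for \<open>Suc j\<close> observations is split by
  \<open>sum_reps_Suc\<close>. Depending on the block chosen, the new observation repeats the value
  \<open>x b\<close> or is a fresh draw \<open>y\<close> from the base measure.\<close>

lemma nn_integral_obs_Suc:
  assumes G: "case_prod G \<in> borel_measurable (PiM {1..j} (\<lambda>_. borel) \<Otimes>\<^sub>M borel)"
  shows "(\<integral>\<^sup>+\<omega>. G (obs j \<omega>) (v (Suc j) \<omega>) \<partial>M) =
    (\<Sum>r\<in>reps j. (\<Sum>b\<in>r ` {1..j}. ennreal (\<pi> (ext_size j r b)) *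
        (\<integral>\<^sup>+x. G (\<lambda>i\<in>{1..j}. x (r i)) (x b) \<partial>PiM {1..j} (\<lambda>_. \<nu>0)))
      + ennreal (\<pi> (ext_size j r (Suc j))) *
        (\<integral>\<^sup>+x. \<integral>\<^sup>+y. G (\<lambda>i\<in>{1..j}. x (r i)) y \<partial>\<nu>0 \<partial>PiM {1..j} (\<lambda>_. \<nu>0)))"
proof -
  let ?P = "\<lambda>n. PiM {1..n} (\<lambda>_::nat. \<nu>0)"
  define F where "F y = G (restrict y {1..j}) (y (Suc j))" for y
  have "(\<lambda>y. case_prod G (restrict y {1..j}, y (Suc j))) \<in> borel_measurable (PiM {1..Suc j} (\<lambda>_. borel))"
    by (rule measurable_compose[OF measurable_Pair G]) (auto intro!: measurable_restrict_subset)
  then have F: "F \<in> borel_measurable (PiM {1..Suc j} (\<lambda>_. borel))" by (simp add: F_def[abs_def])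
  have obsF: "F (obs (Suc j) \<omega>) = G (obs j \<omega>) (v (Suc j) \<omega>)" for \<omega>
    unfolding F_def obs_def by (intro arg_cong2[where f = G]) (auto simp: restrict_def)
  have ins: "{1..Suc j} = insert (Suc j) {1..j}" by auto
  \<comment> \<open>The last coordinate is integrated innermost. It is read only if the last index
    opens its own block, since old codes take values in \<open>{1..j}\<close>.\<close>
  have step: "(\<integral>\<^sup>+x. F (\<lambda>i\<in>{1..Suc j}. x ((r(Suc j := b)) i)) \<partial>?P (Suc j)) =
    (\<integral>\<^sup>+x. \<integral>\<^sup>+y. G (\<lambda>i\<in>{1..j}. x (r i)) (if b = Suc j then y else x b) \<partial>\<nu>0 \<partial>?P j)"
    if r: "r \<in> reps j" and b: "b \<in> insert (Suc j) (r ` {1..j})" for r b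
  proof -
    have "(\<lambda>x. F (\<lambda>i\<in>{1..Suc j}. x ((r(Suc j := b)) i))) \<in> borel_measurable (?P (Suc j))"
      by (rule measurable_compose[OF nu.measurable_reindex[OF reps_upd[OF r b]] F])
    then have "(\<integral>\<^sup>+x. F (\<lambda>i\<in>{1..Suc j}. x ((r(Suc j := b)) i)) \<partial>?P (Suc j)) =
      (\<integral>\<^sup>+x. \<integral>\<^sup>+y. F (\<lambda>i\<in>{1..Suc j}. (x(Suc j := y)) ((r(Suc j := b)) i)) \<partial>\<nu>0 \<partial>?P j)"
      unfolding ins by (rule nu.P.product_nn_integral_insert[rotated 2]) auto
    also have "\<dots> = (\<integral>\<^sup>+x. \<integral>\<^sup>+y. G (\<lambda>i\<in>{1..j}. x (r i)) (if b = Suc j then y else x b) \<partial>\<nu>0 \<partial>?P j)"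
    proof (intro nn_integral_cong)
      fix x y
      show "F (\<lambda>i\<in>{1..Suc j}. (x(Suc j := y)) ((r(Suc j := b)) i)) =
      G (\<lambda>i\<in>{1..j}. x (r i)) (if b = Suc j then y else x b)"
      proof -
      have "restrict (\<lambda>i\<in>{1..Suc j}. (x(Suc j := y)) ((r(Suc j := b)) i)) {1..j} = (\<lambda>i\<in>{1..j}. x (r i))"
        using reps_mem[OF r] by (fastforce simp: restrict_def)
      then show ?thesis unfolding F_def by simp
      qed
    qed
    finally show ?thesis .
  qed
  have old: "(\<integral>\<^sup>+x. F (\<lambda>i\<in>{1..Suc j}. x ((r(Suc j := b)) i)) \<partial>?P (Suc j)) =
    (\<integral>\<^sup>+x. G (\<lambda>i\<in>{1..j}. x (r i)) (x b) \<partial>?P j)" if r: "r \<in> reps j" and b: "b \<in> r ` {1..j}" for r b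
  proof -
    have "b \<noteq> Suc j" using b reps_mem[OF r] by fastforce
    then show ?thesis using step[OF r, of b] b by (simp add: nu.emeasure_space_1[unfolded nu.space_nu0])
  qed
  have new: "(\<integral>\<^sup>+x. F (\<lambda>i\<in>{1..Suc j}. x ((r(Suc j := Suc j)) i)) \<partial>?P (Suc j)) =
    (\<integral>\<^sup>+x. \<integral>\<^sup>+y. G (\<lambda>i\<in>{1..j}. x (r i)) y \<partial>\<nu>0 \<partial>?P j)" if r: "r \<in> reps j" for r
    using step[OF r, of "Suc j"] by simp
  have "(\<integral>\<^sup>+\<omega>. G (obs j \<omega>) (v (Suc j) \<omega>) \<partial>M) = (\<Sum>r\<in>reps (Suc j). ennreal (\<pi> (bsizes (Suc j) r)) *
    (\<integral>\<^sup>+x. F (\<lambda>i\<in>{1..Suc j}. x (r i)) \<partial>?P (Suc j)))"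
    unfolding obsF[symmetric] by (rule nn_integral_obs[OF _ F]) simp
  also have "\<dots> = (\<Sum>r\<in>reps j. (\<Sum>b\<in>r ` {1..j}. ennreal (\<pi> (ext_size j r b)) *
        (\<integral>\<^sup>+x. F (\<lambda>i\<in>{1..Suc j}. x ((r(Suc j := b)) i)) \<partial>?P (Suc j)))
      + ennreal (\<pi> (ext_size j r (Suc j))) *
        (\<integral>\<^sup>+x. F (\<lambda>i\<in>{1..Suc j}. x ((r(Suc j := Suc j)) i)) \<partial>?P (Suc j)))"
    by (rule sum_reps_Suc)
  also have "\<dots> = (\<Sum>r\<in>reps j. (\<Sum>b\<in>r ` {1..j}. ennreal (\<pi> (ext_size j r b)) *
        (\<integral>\<^sup>+x. G (\<lambda>i\<in>{1..j}. x (r i)) (x b) \<partial>?P j))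
      + ennreal (\<pi> (ext_size j r (Suc j))) *
        (\<integral>\<^sup>+x. \<integral>\<^sup>+y. G (\<lambda>i\<in>{1..j}. x (r i)) y \<partial>\<nu>0 \<partial>?P j))"
    by (intro sum.cong refl arg_cong2[where f = "(+)"] arg_cong2[where f = "(*)"] old new)
  finally show ?thesis .
qed

text \<open>The ratios of the prediction rule; if the denominator vanishes, the value is 0.\<close>

definition weight :: "nat \<Rightarrow> (nat \<Rightarrow> nat) \<Rightarrow> nat \<Rightarrow> real" where
  "weight j r b = \<pi> (ext_size j r b) / \<pi> (bsizes j r)"

text \<open>The kernel of \<open>Suc j\<close> observations determines that of the first
  \<open>j\<close>, so the numerator is at most the denominator. When the denominator is 0 so is the
  numerator, and the cancellation stays valid despite division by zero.\<close>

lemma weight_mult: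
  assumes j: "j \<ge> 1" and r: "r \<in> reps j" and b: "b \<in> insert (Suc j) (r ` {1..j})"
  shows "ennreal (\<pi> (bsizes j r)) * ennreal (weight j r b) = ennreal (\<pi> (ext_size j r b))"
    and "0 \<le> weight j r b"
proof -
  let ?r = "r(Suc j := b)"
  have r': "?r \<in> reps (Suc j)" by (rule reps_upd[OF r b])
  have p0: "0 \<le> \<pi> (bsizes j r)" "0 \<le> \<pi> (ext_size j r b)"
    using emeasure_rep(2)[OF j r] emeasure_rep(2)[OF _ r'] by simp_all
  have "rep j x = r" if "rep (Suc j) x = ?r" for x :: "nat \<Rightarrow> real"
  proof
    fix i show "rep j x i = r i"
    proof (cases "i \<in> {1..j}")
      case True
      then show ?thesis using rep_Suc_less[OF True, of x] that by simp
    next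
      case False
      then show ?thesis using reps_ext[OF r] reps_ext[OF rep_in_reps[of j x]] by simp
    qed
  qed
  then have "{\<omega> \<in> space M. rep (Suc j) (\<lambda>i. v i \<omega>) = ?r} \<subseteq> {\<omega> \<in> space M. rep j (\<lambda>i. v i \<omega>) = r}" by blast
  moreover have "{\<omega> \<in> space M. rep j (\<lambda>i. v i \<omega>) = r} \<in> sets M" by (rule sets_rep_v[OF r])
  ultimately have "ennreal (\<pi> (ext_size j r b)) \<le> ennreal (\<pi> (bsizes j r))"
    unfolding emeasure_rep(1)[OF j r, symmetric] using emeasure_rep(1)[OF _ r'] emeasure_mono by fastforce
  then have "\<pi> (ext_size j r b) \<le> \<pi> (bsizes j r)" using p0 by (simp add: ennreal_le_iff)
  then have "\<pi> (bsizes j r) * weight j r b = \<pi> (ext_size j r b)"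
    using p0 by (auto simp: weight_def)
  then show "ennreal (\<pi> (bsizes j r)) * ennreal (weight j r b) = ennreal (\<pi> (ext_size j r b))"
    using p0 by (metis ennreal_mult')
  show "0 \<le> weight j r b" using p0 by (simp add: weight_def)
qed

text \<open>The candidate for the conditional expectation of \<open>G\<close>, applied to the first
  \<open>j\<close> observations and the next one, as a function of the former. Old values are
  addressed by the minima \<open>b\<close> of their blocks.\<close>

definition predict :: "nat \<Rightarrow> ((nat \<Rightarrow> real) \<Rightarrow> real \<Rightarrow> ennreal) \<Rightarrow> (nat \<Rightarrow> real) \<Rightarrow> ennreal" where
  "predict j G x = (\<Sum>b\<in>rep j x ` {1..j}. ennreal (weight j (rep j x) b) * G x (x b))
    + ennreal (weight j (rep j x) (Suc j)) * (\<integral>\<^sup>+y. G x y \<partial>\<nu>0)"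

lemma predict_measurable:
  assumes G: "case_prod G \<in> borel_measurable (PiM {1..j} (\<lambda>_. borel) \<Otimes>\<^sub>M borel)"
  shows "predict j G \<in> borel_measurable (PiM {1..j} (\<lambda>_. borel))"
proof -
  let ?t = "\<lambda>r x. (\<Sum>b\<in>r ` {1..j}. ennreal (weight j r b) * G x (x b))
    + ennreal (weight j r (Suc j)) * (\<integral>\<^sup>+y. G x y \<partial>\<nu>0)"
  have eq: "predict j G x = (\<Sum>r\<in>reps j. indicator {x. rep j x = r} x * ?t r x)" for x
  proof -
    have "(\<Sum>r\<in>reps j. indicator {x. rep j x = r} x * ?t r x) = (\<Sum>r\<in>{rep j x}. indicator {x. rep j x = r} x * ?t r x)"
      by (rule sum.mono_neutral_right) (auto simp: finite_reps rep_in_reps)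
    then show ?thesis by (simp add: predict_def)
  qed
  have "case_prod G \<in> borel_measurable (PiM {1..j} (\<lambda>_. borel) \<Otimes>\<^sub>M \<nu>0)"
    using G by (simp add: measurable_cong_sets[OF sets_pair_measure_cong[OF refl nu.sets_nu0] refl])
  then have Gi: "(\<lambda>x. \<integral>\<^sup>+y. G x y \<partial>\<nu>0) \<in> borel_measurable (PiM {1..j} (\<lambda>_. borel))"
    by (rule nu.borel_measurable_nn_integral)
  have Gb: "(\<lambda>x. G x (x b)) \<in> borel_measurable (PiM {1..j} (\<lambda>_. borel))" if "b \<in> {1..j}" for b
    using measurable_compose[OF measurable_Pair[OF measurable_ident measurable_component_singleton[OF that]] G] by simp
  have "(\<lambda>x. indicator {x. rep j x = r} x * ?t r x) \<in> borel_measurable (PiM {1..j} (\<lambda>_. borel))" if r: "r \<in> reps j" for r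
    using reps_mem[OF r]
    by (intro borel_measurable_times_ennreal borel_measurable_add borel_measurable_sum borel_measurable_const Gi Gb
        borel_measurable_indicator_pred sets_rep_eq[OF r]) auto
  then show ?thesis unfolding eq by (intro borel_measurable_sum)
qed

text \<open>Both sides are sums over codes \<open>r\<close> and agree term by term: a weight
  multiplied by the EPPF value of \<open>r\<close> is the EPPF value of the extended code.\<close>

lemma nn_integral_predict:
  assumes j: "j \<ge> 1" and G: "case_prod G \<in> borel_measurable (PiM {1..j} (\<lambda>_. borel) \<Otimes>\<^sub>M borel)"
  shows "(\<integral>\<^sup>+\<omega>. G (obs j \<omega>) (v (Suc j) \<omega>) \<partial>M) = (\<integral>\<^sup>+\<omega>. predict j G (obs j \<omega>) \<partial>M)"
proof -
  let ?P = "PiM {1..j} (\<lambda>_::nat. \<nu>0)"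
  let ?x = "\<lambda>x r. \<lambda>i\<in>{1..j}. x (r i)"
  have "(\<Sum>b\<in>r ` {1..j}. ennreal (\<pi> (ext_size j r b)) * (\<integral>\<^sup>+x. G (?x x r) (x b) \<partial>?P))
      + ennreal (\<pi> (ext_size j r (Suc j))) * (\<integral>\<^sup>+x. \<integral>\<^sup>+y. G (?x x r) y \<partial>\<nu>0 \<partial>?P)
    = ennreal (\<pi> (bsizes j r)) * (\<integral>\<^sup>+x. predict j G (?x x r) \<partial>?P)" if r: "r \<in> reps j" for r
  proof -
    have sub: "b \<in> {1..j}" "r b = b" if "b \<in> r ` {1..j}" for b
      using that reps_mem[OF r] reps_idem[OF r] by auto
    have jj: "j \<in> {1..j}" using j by simp
    have m1: "(\<lambda>x. ennreal (weight j r b) * G (?x x r) (x b)) \<in> borel_measurable ?P" if "b \<in> r ` {1..j}" for b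
      by (intro borel_measurable_times_ennreal borel_measurable_const measurable_reindexed(1)[OF G r sub(1)[OF that]])
    have m2: "(\<lambda>x. ennreal (weight j r (Suc j)) * (\<integral>\<^sup>+y. G (?x x r) y \<partial>\<nu>0)) \<in> borel_measurable ?P"
      by (intro borel_measurable_times_ennreal borel_measurable_const measurable_reindexed(2)[OF G r jj])
    \<comment> \<open>Filling the blocks with distinct values restores the code \<open>r\<close>,
      and the value at a block minimum \<open>b\<close> is \<open>x b\<close> because
      \<open>r b = b\<close>.\<close>
    have "AE x in ?P. predict j G (?x x r) = (\<Sum>b\<in>r ` {1..j}. ennreal (weight j r b) * G (?x x r) (x b))
      + ennreal (weight j r (Suc j)) * (\<integral>\<^sup>+y. G (?x x r) y \<partial>\<nu>0)"
      using nu.AE_PiM_inj_on[of "{1..j}", OF finite_atLeastAtMost]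
    proof eventually_elim
      fix x :: "nat \<Rightarrow> real" assume "inj_on x {1..j}"
      then have rr: "rep j (?x x r) = r" by (rule rep_inj_comp[OF r])
      have "(?x x r) b = x b" if "b \<in> r ` {1..j}" for b
        using sub[OF that] by simp
      then show "predict j G (?x x r) = (\<Sum>b\<in>r ` {1..j}. ennreal (weight j r b) * G (?x x r) (x b))
        + ennreal (weight j r (Suc j)) * (\<integral>\<^sup>+y. G (?x x r) y \<partial>\<nu>0)"
        unfolding predict_def rr by (intro arg_cong2[where f = "(+)"] sum.cong refl) simp
    qed
    then have "(\<integral>\<^sup>+x. predict j G (?x x r) \<partial>?P) = (\<integral>\<^sup>+x. (\<Sum>b\<in>r ` {1..j}. ennreal (weight j r b) * G (?x x r) (x b))
      + ennreal (weight j r (Suc j)) * (\<integral>\<^sup>+y. G (?x x r) y \<partial>\<nu>0) \<partial>?P)"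
      by (rule nn_integral_cong_AE)
    also have "\<dots> = (\<integral>\<^sup>+x. (\<Sum>b\<in>r ` {1..j}. ennreal (weight j r b) * G (?x x r) (x b)) \<partial>?P)
      + (\<integral>\<^sup>+x. ennreal (weight j r (Suc j)) * (\<integral>\<^sup>+y. G (?x x r) y \<partial>\<nu>0) \<partial>?P)"
      by (rule nn_integral_add[OF borel_measurable_sum[OF m1] m2])
    also have "(\<integral>\<^sup>+x. (\<Sum>b\<in>r ` {1..j}. ennreal (weight j r b) * G (?x x r) (x b)) \<partial>?P) =
      (\<Sum>b\<in>r ` {1..j}. (\<integral>\<^sup>+x. ennreal (weight j r b) * G (?x x r) (x b) \<partial>?P))"
      by (rule nn_integral_sum[OF m1])
    also have "\<dots> = (\<Sum>b\<in>r ` {1..j}. ennreal (weight j r b) * (\<integral>\<^sup>+x. G (?x x r) (x b) \<partial>?P))"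
      by (intro sum.cong refl nn_integral_cmult measurable_reindexed(1)[OF G r sub(1)])
    also have "(\<integral>\<^sup>+x. ennreal (weight j r (Suc j)) * (\<integral>\<^sup>+y. G (?x x r) y \<partial>\<nu>0) \<partial>?P) =
      ennreal (weight j r (Suc j)) * (\<integral>\<^sup>+x. (\<integral>\<^sup>+y. G (?x x r) y \<partial>\<nu>0) \<partial>?P)"
      by (rule nn_integral_cmult[OF measurable_reindexed(2)[OF G r jj]])
    finally have E: "(\<integral>\<^sup>+x. predict j G (?x x r) \<partial>?P) = (\<Sum>b\<in>r ` {1..j}. ennreal (weight j r b) * (\<integral>\<^sup>+x. G (?x x r) (x b) \<partial>?P))
      + ennreal (weight j r (Suc j)) * (\<integral>\<^sup>+x. (\<integral>\<^sup>+y. G (?x x r) y \<partial>\<nu>0) \<partial>?P)" .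
    show ?thesis
      unfolding E distrib_left sum_distrib_left mult.assoc[symmetric]
      by (intro arg_cong2[where f = "(+)"] sum.cong refl arg_cong2[where f = "(*)"] weight_mult(1)[OF j r, symmetric]) simp_all
  qed
  then have "(\<integral>\<^sup>+\<omega>. G (obs j \<omega>) (v (Suc j) \<omega>) \<partial>M) =
    (\<Sum>r\<in>reps j. ennreal (\<pi> (bsizes j r)) * (\<integral>\<^sup>+x. predict j G (?x x r) \<partial>?P))"
    unfolding nn_integral_obs_Suc[OF G] by (intro sum.cong refl)
  also have "\<dots> = (\<integral>\<^sup>+\<omega>. predict j G (obs j \<omega>) \<partial>M)"
    by (rule nn_integral_obs[OF j predict_measurable[OF G], symmetric])
  finally show ?thesis .
qed

end

section \<open>Stick-breaking weights\<close>

lemma cfun_ge: "0 \<le> x \<Longrightarrow> x \<le> 1 \<Longrightarrow> x \<le> cfun x"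
  by (auto simp: cfun_def field_simps)

text \<open>Denominators are cleared. At \<open>x = 1\<close> both sides hold, since
  \<open>cfun 1 = 1\<close> and \<open>z \<le> 1\<close>.\<close>

lemma le_cfun_iff: "0 \<le> x \<Longrightarrow> x \<le> 1 \<Longrightarrow> z \<le> 1 \<Longrightarrow> z \<le> cfun x \<longleftrightarrow> z * (1 - x) \<le> x"
  by (auto simp: cfun_def pos_le_divide_eq)

lemma cfun_measurable [measurable]: "cfun \<in> borel_measurable borel"
  unfolding cfun_def[abs_def] by measurable

text \<open>The sum telescopes to the part of the stick left over before step \<open>i\<close>.
  Dividing by it recovers \<open>v i\<close> from the stick lengths.\<close>

lemma one_minus_sum_stick:
  "1 - (\<Sum>l\<in>{1..<i}. stick v l \<omega>) = (\<Prod>l\<in>{1..<i}. 1 - v l \<omega>)"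
proof (induction i)
  case (Suc i)
  show ?case
  proof (cases "i = 0")
    case False
    then have "{1..<Suc i} = insert i {1..<i}" by auto
    then show ?thesis using Suc by (simp add: stick_def algebra_simps)
  qed simp
qed simp

section \<open>Laws of one and of two consecutive observations\<close>

context ssp_sample
begin

lemma emeasure_atMost: "emeasure \<nu>0 {..t} = ennreal (cdf0 \<nu>0 t)"
proof -
  have "AE y in \<nu>0. y \<in> {0..1}"
    using nu.prob_eq_1[of "{0..1}"] nu0_supp by (simp add: nu.sets_nu0)
  then have "emeasure \<nu>0 {..t} = emeasure \<nu>0 {0..t}"
    by (intro emeasure_eq_AE) (auto simp: nu.sets_nu0)
  then show ?thesis by (simp add: cdf0_def nu.emeasure_eq_measure)
qed

lemma cdf0_nonneg [simp]: "0 \<le> cdf0 \<nu>0 t" by (simp add: cdf0_def)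

lemma cdf0_measurable [measurable]: "cdf0 \<nu>0 \<in> borel_measurable borel"
  by (rule borel_measurable_mono) (auto simp: mono_def cdf0_def nu.sets_nu0 intro!: nu.finite_measure_mono)

lemma reps_1: "reps 1 = {\<lambda>i\<in>{1..1}. 1}"
proof -
  have "rep 1 x = (\<lambda>i\<in>{1..1}. 1)" for x :: "nat \<Rightarrow> nat"
    using rep_mem[of 1 1 x] by (auto simp: rep_def fun_eq_iff restrict_def)
  then show ?thesis by (auto simp: reps_def)
qed

text \<open>A single index has only one partition, so by stationarity the law of \<open>v k\<close>
  is a multiple of the base measure; the constant function 1 shows that the factor is 1.\<close>

lemma nn_integral_obs_1:
  assumes f [measurable]: "f \<in> borel_measurable borel" and k: "k \<ge> 1"
  shows "(\<integral>\<^sup>+\<omega>. f (v k \<omega>) \<partial>M) = (\<integral>\<^sup>+x. f x \<partial>\<nu>0)"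
proof -
  define r where "r = (\<lambda>i\<in>{1..1::nat}. 1::nat)"
  have single: "(\<integral>\<^sup>+x. f (x 1) \<partial>PiM {1..1::nat} (\<lambda>_. \<nu>0)) = (\<integral>\<^sup>+x. f x \<partial>\<nu>0)" if "f \<in> borel_measurable borel" for f
    using nu.P.product_nn_integral_singleton[of f 1] that by (simp add: measurable_cong_sets[OF nu.sets_nu0 refl])
  have gen: "(\<integral>\<^sup>+\<omega>. f (v k \<omega>) \<partial>M) = ennreal (\<pi> (bsizes 1 r)) * (\<integral>\<^sup>+x. f x \<partial>\<nu>0)"
    if f: "f \<in> borel_measurable borel" for f
  proof -
    have fm: "(\<lambda>x. f (x 1)) \<in> borel_measurable (PiM {1..1::nat} (\<lambda>_. borel))"
      by (intro measurable_compose[OF measurable_component_singleton[of 1 "{1..1}" "\<lambda>_. borel"] f]) simp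
    have "(\<integral>\<^sup>+\<omega>. f (v k \<omega>) \<partial>M) = (\<integral>\<^sup>+\<omega>. f (shift_obs (k - 1) 1 \<omega> 1) \<partial>M)"
      using k by (simp add: shift_obs_def)
    also have "\<dots> = (\<integral>\<^sup>+\<omega>. f (obs 1 \<omega> 1) \<partial>M)"
      by (rule nn_integral_shift_obs[OF fm])
    also have "\<dots> = ennreal (\<pi> (bsizes 1 r)) * (\<integral>\<^sup>+x. f (x 1) \<partial>PiM {1..1::nat} (\<lambda>_. \<nu>0))"
      using nn_integral_obs[OF _ fm] unfolding reps_1 by (simp add: r_def)
    finally show ?thesis unfolding single[OF f] .
  qed
  have "ennreal (\<pi> (bsizes 1 r)) = 1"
    using gen[of "\<lambda>_. 1"] by (simp add: emeasure_space_1 nu.emeasure_space_1[unfolded nu.space_nu0])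
  then show ?thesis using gen[OF f] by simp
qed

text \<open>The marginal law is diffuse, so the value 1, which would use up the stick, has
  probability zero.\<close>

lemma AE_v_neq_1: "AE \<omega> in M. \<forall>i\<in>{1..n}. v i \<omega> \<noteq> 1"
proof (rule AE_finite_allI)
  fix i assume "i \<in> {1..n}"
  then have "(\<integral>\<^sup>+\<omega>. indicator {1} (v i \<omega>) \<partial>M) = (\<integral>\<^sup>+x. indicator {1} x \<partial>\<nu>0)"
    by (intro nn_integral_obs_1) auto
  also have "\<dots> = 0" by (simp add: nu.sets_nu0 nu.nu0_singleton)
  finally have "AE \<omega> in M. (indicator {1} (v i \<omega>) :: ennreal) = 0"
    by (subst (asm) nn_integral_0_iff_AE) auto
  then show "AE \<omega> in M. v i \<omega> \<noteq> 1"
    by eventually_elim (auto simp: indicator_def)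
qed simp

text \<open>Stationarity moves the pair to the first two observations, where the second either
  repeats the first or is a fresh draw.\<close>

lemma nn_integral_consecutive:
  assumes G: "case_prod G \<in> borel_measurable (borel \<Otimes>\<^sub>M borel)" and k: "k \<ge> 1"
  shows "(\<integral>\<^sup>+\<omega>. G (v k \<omega>) (v (Suc k) \<omega>) \<partial>M) =
    ennreal (\<pi> {#2#}) * (\<integral>\<^sup>+x. G x x \<partial>\<nu>0) + ennreal (\<pi> {#1, 1#}) * (\<integral>\<^sup>+x. \<integral>\<^sup>+y. G x y \<partial>\<nu>0 \<partial>\<nu>0)"
proof -
  define r where "r = (\<lambda>i\<in>{1..1::nat}. 1::nat)"
  have b1: "bsizes 1 r = {#1#}" by (simp add: bsizes_def r_def)
  have b2: "ext_size 1 r 1 = {#2#}" "ext_size 1 r (Suc 1) = {#1, 1#}"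
    using bsizes_upd_old[of 1 r 1] bsizes_upd_new[of "Suc 1" r 1] b1 by (simp_all add: r_def)
  have single: "(\<integral>\<^sup>+x. f (x 1) \<partial>PiM {1..1::nat} (\<lambda>_. \<nu>0)) = (\<integral>\<^sup>+x. f x \<partial>\<nu>0)" if "f \<in> borel_measurable borel" for f
    using nu.P.product_nn_integral_singleton[of f 1] that by (simp add: measurable_cong_sets[OF nu.sets_nu0 refl])
  have c: "(\<lambda>x. x i) \<in> measurable (PiM {1..n} (\<lambda>_. borel :: real measure)) borel" if "i \<in> {1..n::nat}" for i n
    using that by (rule measurable_component_singleton)
  have F: "(\<lambda>x. case_prod G (x 1, x (Suc 1))) \<in> borel_measurable (PiM {1..Suc 1} (\<lambda>_. borel))"
    by (intro measurable_compose[OF measurable_Pair[OF c c] G]) auto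
  have H: "(\<lambda>(x, y). G (x 1) y) \<in> borel_measurable (PiM {1..1::nat} (\<lambda>_. borel) \<Otimes>\<^sub>M borel)"
    using measurable_compose[OF measurable_Pair[OF measurable_compose[OF measurable_fst c] measurable_snd] G, of 1 1]
    by (simp add: case_prod_beta')
  have d: "(\<lambda>x. G x x) \<in> borel_measurable borel"
    using measurable_compose[OF measurable_Pair[OF measurable_ident measurable_ident] G] by simp
  have "case_prod G \<in> borel_measurable (borel \<Otimes>\<^sub>M \<nu>0)"
    using G by (simp add: measurable_cong_sets[OF sets_pair_measure_cong[OF refl nu.sets_nu0] refl])
  then have i: "(\<lambda>x. \<integral>\<^sup>+y. G x y \<partial>\<nu>0) \<in> borel_measurable borel"
    by (rule nu.borel_measurable_nn_integral)
  have "(\<integral>\<^sup>+\<omega>. G (v k \<omega>) (v (Suc k) \<omega>) \<partial>M) = (\<integral>\<^sup>+\<omega>. case_prod G (shift_obs (k - 1) (Suc 1) \<omega> 1, shift_obs (k - 1) (Suc 1) \<omega> (Suc 1)) \<partial>M)"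
    using k by (simp add: shift_obs_def)
  also have "\<dots> = (\<integral>\<^sup>+\<omega>. case_prod G (obs (Suc 1) \<omega> 1, obs (Suc 1) \<omega> (Suc 1)) \<partial>M)"
    by (rule nn_integral_shift_obs[OF F])
  also have "\<dots> = (\<integral>\<^sup>+\<omega>. (\<lambda>x. G (x 1)) (obs 1 \<omega>) (v (Suc 1) \<omega>) \<partial>M)"
    by (simp add: obs_def)
  also have "\<dots> = ennreal (\<pi> (ext_size 1 r 1)) * (\<integral>\<^sup>+x. G (x 1) (x 1) \<partial>PiM {1..1::nat} (\<lambda>_. \<nu>0))
    + ennreal (\<pi> (ext_size 1 r (Suc 1))) * (\<integral>\<^sup>+x. \<integral>\<^sup>+y. G (x 1) y \<partial>\<nu>0 \<partial>PiM {1..1::nat} (\<lambda>_. \<nu>0))"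
    unfolding nn_integral_obs_Suc[OF H] reps_1 r_def by simp
  finally show ?thesis unfolding single[OF d] single[OF i] b2 .
qed

lemma eppf_two: "0 \<le> \<pi> {#2#}" "0 \<le> \<pi> {#1, 1#}" "\<pi> {#1, 1#} = 1 - \<pi> {#2#}"
proof -
  define r where "r = (\<lambda>i\<in>{1..1::nat}. 1::nat)"
  have b1: "bsizes 1 r = {#1#}" by (simp add: bsizes_def r_def)
  have b2: "ext_size 1 r 1 = {#2#}" "ext_size 1 r (Suc 1) = {#1, 1#}"
    using bsizes_upd_old[of 1 r 1] bsizes_upd_new[of "Suc 1" r 1] b1 by (simp_all add: r_def)
  have r: "r \<in> reps 1" unfolding reps_1 r_def by simp
  have "0 \<le> \<pi> (ext_size 1 r 1)" "0 \<le> \<pi> (ext_size 1 r (Suc 1))"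
    by (rule emeasure_rep(2)[OF _ reps_upd[OF r]]; simp add: r_def)+
  then show p: "0 \<le> \<pi> {#2#}" "0 \<le> \<pi> {#1, 1#}" unfolding b2 .
  \<comment> \<open>Total mass: the two-observation formula is tested with the constant 1.\<close>
  have "1 = ennreal (\<pi> {#2#}) + ennreal (\<pi> {#1, 1#})"
    using nn_integral_consecutive[of "\<lambda>_ _. 1" 1]
    by (simp add: emeasure_space_1 nu.emeasure_space_1[unfolded nu.space_nu0])
  then have "ennreal 1 = ennreal (\<pi> {#2#} + \<pi> {#1, 1#})" using p by simp
  then show "\<pi> {#1, 1#} = 1 - \<pi> {#2#}" using p by (subst (asm) ennreal_inj) auto
qed

text \<open>Both sticks contain the factor \<open>?R\<close>, the part left over before step
  \<open>j\<close>. It is positive as none of its factors vanishes, and after cancelling it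
  \<open>le_cfun_iff\<close> applies.\<close>

lemma stick_le_iff:
  assumes \<omega>: "\<omega> \<in> space M" and ne: "\<forall>i\<in>{1..j}. v i \<omega> \<noteq> 1" and j: "j \<ge> 1"
  shows "stick v (Suc j) \<omega> \<le> stick v j \<omega> \<longleftrightarrow> v (Suc j) \<omega> \<le> cfun (v j \<omega>)"
proof -
  let ?R = "\<Prod>i\<in>{1..<j}. 1 - v i \<omega>"
  have "0 < ?R"
    using ne v_range[OF _ \<omega>] by (intro prod_pos) (force simp: less_le)
  have "{1..<Suc j} = insert j {1..<j}" using j by auto
  then have "(\<Prod>i\<in>{1..<Suc j}. 1 - v i \<omega>) = (1 - v j \<omega>) * ?R" by simp
  then have "stick v (Suc j) \<omega> = (v (Suc j) \<omega> * (1 - v j \<omega>)) * ?R"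
    unfolding stick_def by (simp only: mult.assoc)
  then have "stick v (Suc j) \<omega> \<le> stick v j \<omega> \<longleftrightarrow> v (Suc j) \<omega> * (1 - v j \<omega>) \<le> v j \<omega>"
    using mult_le_cancel_right_pos[OF \<open>0 < ?R\<close>] by (simp only: stick_def)
  also have "\<dots> \<longleftrightarrow> v (Suc j) \<omega> \<le> cfun (v j \<omega>)"
    using v_range[OF j \<omega>] v_range[of "Suc j", OF _ \<omega>] by (subst le_cfun_iff) auto
  finally show ?thesis .
qed

lemma stick_measurable:
  assumes "j \<ge> 1" "\<And>i. i \<in> {1..j} \<Longrightarrow> v i \<in> borel_measurable N"
  shows "stick v j \<in> borel_measurable N"
  unfolding stick_def[abs_def] using assms
  by (intro borel_measurable_times borel_measurable_prod borel_measurable_diff borel_measurable_const) auto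

text \<open>By \<open>stick_le_iff\<close> the event concerns a consecutive pair only. On a tie the
  comparison holds almost surely, as \<open>x \<le> cfun x\<close> on the unit interval; a fresh
  draw gives the distribution function at \<open>cfun x\<close>.\<close>

lemma prob_stick_le:
  assumes j: "j \<ge> 1"
  shows "measure M {\<omega> \<in> space M. stick v (Suc j) \<omega> \<le> stick v j \<omega>}
    = \<pi> {#2#} + (1 - \<pi> {#2#}) * (\<integral>x. cdf0 \<nu>0 (cfun x) \<partial>\<nu>0)"
proof -
  let ?S = "{\<omega> \<in> space M. stick v (Suc j) \<omega> \<le> stick v j \<omega>}"
  have [measurable]: "stick v j \<in> borel_measurable M" "stick v (Suc j) \<in> borel_measurable M"
    using j by (auto intro!: stick_measurable)
  have G: "(\<lambda>(x, z). indicator {..cfun x} z :: ennreal) \<in> borel_measurable (borel \<Otimes>\<^sub>M borel)"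
  proof -
    have "(\<lambda>p. indicator {p. snd p \<le> cfun (fst p)} p :: ennreal) \<in> borel_measurable (borel \<Otimes>\<^sub>M borel)"
      by (intro borel_measurable_indicator_pred borel_measurable_le) measurable
    then show ?thesis by (simp add: indicator_def case_prod_beta')
  qed
  have nu_le: "AE x in \<nu>0. x \<in> {0..1}"
    using nu.prob_eq_1[of "{0..1}"] nu0_supp by (simp add: nu.sets_nu0)
  have int: "integrable \<nu>0 (\<lambda>x. cdf0 \<nu>0 (cfun x))"
  proof (rule nu.integrable_const_bound[where B = 1])
    show "(\<lambda>x. cdf0 \<nu>0 (cfun x)) \<in> borel_measurable \<nu>0" by measurable
  qed (simp add: cdf0_def)
  have "emeasure M ?S = (\<integral>\<^sup>+\<omega>. indicator ?S \<omega> \<partial>M)" by simp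
  also have "\<dots> = (\<integral>\<^sup>+\<omega>. indicator {..cfun (v j \<omega>)} (v (Suc j) \<omega>) \<partial>M)"
  proof (rule nn_integral_cong_AE)
    show "AE \<omega> in M. (indicator ?S \<omega> :: ennreal) = indicator {..cfun (v j \<omega>)} (v (Suc j) \<omega>)"
      using AE_v_neq_1[of j] AE_space by eventually_elim (use stick_le_iff j in \<open>simp add: indicator_def\<close>)
  qed
  also have "\<dots> = ennreal (\<pi> {#2#}) * (\<integral>\<^sup>+x. indicator {..cfun x} x \<partial>\<nu>0) +
    ennreal (\<pi> {#1, 1#}) * (\<integral>\<^sup>+x. \<integral>\<^sup>+y. indicator {..cfun x} y \<partial>\<nu>0 \<partial>\<nu>0)"
    by (rule nn_integral_consecutive[OF G j])
  also have "(\<integral>\<^sup>+x. indicator {..cfun x} x \<partial>\<nu>0) = (\<integral>\<^sup>+x. 1 \<partial>\<nu>0)"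
    by (rule nn_integral_cong_AE) (use nu_le in eventually_elim, simp add: cfun_ge)
  also have "\<dots> = 1" by (simp add: nu.emeasure_space_1[unfolded nu.space_nu0])
  also have "(\<integral>\<^sup>+x. \<integral>\<^sup>+y. indicator {..cfun x} y \<partial>\<nu>0 \<partial>\<nu>0) = (\<integral>\<^sup>+x. ennreal (cdf0 \<nu>0 (cfun x)) \<partial>\<nu>0)"
    by (simp add: nu.sets_nu0 emeasure_atMost)
  also have "\<dots> = ennreal (\<integral>x. cdf0 \<nu>0 (cfun x) \<partial>\<nu>0)"
    by (rule nn_integral_eq_integral[OF int]) simp
  finally have "ennreal (measure M ?S) = ennreal (\<pi> {#2#} + \<pi> {#1, 1#} * (\<integral>x. cdf0 \<nu>0 (cfun x) \<partial>\<nu>0))"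
    using eppf_two by (simp add: emeasure_eq_measure ennreal_mult ennreal_plus)
  then have "measure M ?S = \<pi> {#2#} + \<pi> {#1, 1#} * (\<integral>x. cdf0 \<nu>0 (cfun x) \<partial>\<nu>0)"
    using eppf_two by (subst (asm) ennreal_inj) (auto intro!: add_nonneg_nonneg mult_nonneg_nonneg)
  then show ?thesis unfolding eppf_two(3) .
qed

section \<open>Conditioning on the observations\<close>

abbreviation cfun_event :: "nat \<Rightarrow> 'a set" where
  "cfun_event j \<equiv> {\<omega> \<in> space M. v (Suc j) \<omega> \<le> cfun (v j \<omega>)}"

text \<open>The sum over distinct values becomes a sum over block minima: \<open>b\<close> maps
  bijectively to the value \<open>v b \<omega>\<close>, and multiplicities are block sizes.\<close>

lemma predict_obs:
  assumes j: "j \<ge> 1"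
  shows "predict j (\<lambda>x. indicator {..cfun (x j)}) (obs j \<omega>) = ennreal (pred_formula \<pi> \<nu>0 v j \<omega>)"
    and "0 \<le> pred_formula \<pi> \<nu>0 v j \<omega>"
proof -
  define r where "r = rep j (\<lambda>i. v i \<omega>)"
  define t where "t = cfun (v j \<omega>)"
  have r: "r \<in> reps j" unfolding r_def by (rule rep_in_reps)
  have r_iff: "v i \<omega> = v l \<omega> \<longleftrightarrow> r i = r l" if "i \<in> {1..j}" "l \<in> {1..j}" for i l
    unfolding r_def using rep_eq_iff[OF that, of "\<lambda>i. v i \<omega>"] by simp
  have sub: "b \<in> {1..j}" "r b = b" if "b \<in> r ` {1..j}" for b
    using that reps_mem[OF r] reps_idem[OF r] by auto
  have n: "count_vec v j \<omega> = bsizes j r"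
  proof -
    have "count_vec v j \<omega> = bsizes j (\<lambda>i. v i \<omega>)"
      by (simp add: count_vec_def bsizes_def distinct_vals_def mult_count_def[abs_def])
    also have "\<dots> = bsizes j r" unfolding r_def by (rule bsizes_cong) (simp add: rep_rep)
    finally show ?thesis .
  qed
  have mc: "mult_count v j \<omega> (v b \<omega>) = card {l \<in> {1..j}. r l = b}" if b: "b \<in> r ` {1..j}" for b
  proof -
    have "v l \<omega> = v b \<omega> \<longleftrightarrow> r l = b" if l: "l \<in> {1..j}" for l
      using r_iff[OF l sub(1)[OF b]] sub(2)[OF b] by simp
    then show ?thesis unfolding mult_count_def by (intro arg_cong[where f = card] Collect_cong conj_cong refl)
  qed
  have old: "\<pi> (add_mset (mult_count v j \<omega> (v b \<omega>) + 1) (bsizes j r - {#mult_count v j \<omega> (v b \<omega>)#})) / \<pi> (bsizes j r)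
    = weight j r b" if "b \<in> r ` {1..j}" for b
    unfolding weight_def mc[OF that] bsizes_upd_old[OF that] ..
  have "Suc j \<notin> r ` {1..j}" using sub(1)[of "Suc j"] by auto
  then have new: "\<pi> (add_mset 1 (bsizes j r)) / \<pi> (bsizes j r) = weight j r (Suc j)"
    unfolding weight_def by (subst bsizes_upd_new) simp_all
  have dv: "distinct_vals v j \<omega> = (\<lambda>b. v b \<omega>) ` (r ` {1..j})"
    unfolding distinct_vals_def image_image r_def using rep_val[of _ j "\<lambda>i. v i \<omega>"] by (intro image_cong) auto
  have inj: "inj_on (\<lambda>b. v b \<omega>) (r ` {1..j})"
  proof (rule inj_onI)
    fix b c assume bc: "b \<in> r ` {1..j}" "c \<in> r ` {1..j}" "v b \<omega> = v c \<omega>"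
    then have "r b = r c" using r_iff[OF sub(1)[OF bc(1)] sub(1)[OF bc(2)]] by simp
    then show "b = c" using sub(2)[OF bc(1)] sub(2)[OF bc(2)] by simp
  qed
  have pf: "pred_formula \<pi> \<nu>0 v j \<omega> = (\<Sum>b\<in>r ` {1..j}. weight j r b * indicator {..t} (v b \<omega>)) + weight j r (Suc j) * cdf0 \<nu>0 t"
    unfolding pred_formula_def Let_def n dv sum.reindex[OF inj] comp_def new t_def[symmetric]
    using old by (intro arg_cong2[where f = "(+)"] sum.cong refl) simp
  have w: "0 \<le> weight j r b" if "b \<in> insert (Suc j) (r ` {1..j})" for b
    by (rule weight_mult(2)[OF j r that])
  have nn: "0 \<le> (\<Sum>b\<in>r ` {1..j}. weight j r b * indicator {..t} (v b \<omega>))" "0 \<le> weight j r (Suc j) * cdf0 \<nu>0 t"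
    using w by (auto intro!: sum_nonneg mult_nonneg_nonneg)
  then show "0 \<le> pred_formula \<pi> \<nu>0 v j \<omega>" unfolding pf by simp
  have ob: "obs j \<omega> b = v b \<omega>" if "b \<in> {1..j}" for b using that by (simp add: obs_def)
  have tj: "cfun (obs j \<omega> j) = t" using j by (simp add: ob t_def)
  have "predict j (\<lambda>x. indicator {..cfun (x j)}) (obs j \<omega>) =
    (\<Sum>b\<in>r ` {1..j}. ennreal (weight j r b) * indicator {..t} (obs j \<omega> b)) + ennreal (weight j r (Suc j)) * (\<integral>\<^sup>+y. indicator {..t} y \<partial>\<nu>0)"
    unfolding predict_def rep_obs r_def[symmetric] tj ..
  also have "(\<Sum>b\<in>r ` {1..j}. ennreal (weight j r b) * indicator {..t} (obs j \<omega> b)) =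
    (\<Sum>b\<in>r ` {1..j}. ennreal (weight j r b * indicator {..t} (v b \<omega>)))"
    using ob[OF sub(1)] by (intro sum.cong refl) (simp add: indicator_def)
  also have "\<dots> = ennreal (\<Sum>b\<in>r ` {1..j}. weight j r b * indicator {..t} (v b \<omega>))"
    using w by (intro sum_ennreal) simp
  also have "ennreal (weight j r (Suc j)) * (\<integral>\<^sup>+y. indicator {..t} y \<partial>\<nu>0) = ennreal (weight j r (Suc j) * cdf0 \<nu>0 t)"
    using w by (simp add: nu.sets_nu0 emeasure_atMost ennreal_mult)
  finally show "predict j (\<lambda>x. indicator {..cfun (x j)}) (obs j \<omega>) = ennreal (pred_formula \<pi> \<nu>0 v j \<omega>)"
    unfolding pf using nn by simp
qed

lemma indicator_cfun_measurable:
  fixes j :: nat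
  assumes j: "j \<ge> 1"
  shows "(\<lambda>(x, z). indicator {..cfun (x j)} z :: ennreal) \<in> borel_measurable (PiM {1..j} (\<lambda>_. borel) \<Otimes>\<^sub>M borel)"
proof -
  have [measurable]: "(\<lambda>p. fst p j) \<in> borel_measurable (PiM {1..j} (\<lambda>_. borel :: real measure) \<Otimes>\<^sub>M (borel :: real measure))"
    using j by (intro measurable_compose[OF measurable_fst measurable_component_singleton]) simp
  have "(\<lambda>p. indicator {p. snd p \<le> cfun (fst p j)} p :: ennreal) \<in> borel_measurable (PiM {1..j} (\<lambda>_. borel :: real measure) \<Otimes>\<^sub>M borel)"
    by (intro borel_measurable_indicator_pred borel_measurable_le measurable_compose[OF _ cfun_measurable] measurable_snd) fact
  then show ?thesis by (simp add: indicator_def case_prod_beta')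
qed

lemma predict_cfun_measurable:
  "j \<ge> 1 \<Longrightarrow> predict j (\<lambda>x. indicator {..cfun (x j)}) \<in> borel_measurable (PiM {1..j} (\<lambda>_. borel))"
  by (rule predict_measurable[OF indicator_cfun_measurable])

lemma pred_formula_eq: "j \<ge> 1 \<Longrightarrow> pred_formula \<pi> \<nu>0 v j \<omega> = enn2real (predict j (\<lambda>x. indicator {..cfun (x j)}) (obs j \<omega>))"
  by (simp add: predict_obs)

text \<open>The formula depends on the sample through \<open>obs j\<close> alone. The sigma-algebra
  is left general, as the lemma is applied both to \<open>M\<close> and to the one generated by the
  observations.\<close>

lemma pred_formula_measurable:
  assumes "j \<ge> 1" "\<And>i. i \<in> {1..j} \<Longrightarrow> v i \<in> borel_measurable N"
  shows "pred_formula \<pi> \<nu>0 v j \<in> borel_measurable N"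
proof -
  have "obs j \<in> measurable N (PiM {1..j} (\<lambda>_. borel))"
    unfolding obs_def[abs_def] using assms(2) by (intro measurable_restrict)
  from borel_measurable_enn2real[OF measurable_compose[OF this predict_cfun_measurable[OF assms(1)]]]
  show ?thesis using pred_formula_eq[OF assms(1)] by (simp cong: measurable_cong)
qed

text \<open>This is the defining identity of conditional expectation for test sets in the
  sigma-algebra of \<open>obs j\<close>, obtained by putting the test set into
  \<open>?G\<close>.\<close>

lemma nn_integral_pred_formula:
  assumes j: "j \<ge> 1" and B: "B \<in> sets (PiM {1..j} (\<lambda>_. borel))"
  shows "(\<integral>\<^sup>+\<omega>. indicator B (obs j \<omega>) * indicator (cfun_event j) \<omega> \<partial>M) =
    (\<integral>\<^sup>+\<omega>. indicator B (obs j \<omega>) * ennreal (pred_formula \<pi> \<nu>0 v j \<omega>) \<partial>M)"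
proof -
  let ?G = "\<lambda>x z. indicator B x * indicator {..cfun (x j)} z :: ennreal"
  have G: "case_prod ?G \<in> borel_measurable (PiM {1..j} (\<lambda>_. borel) \<Otimes>\<^sub>M borel)"
    using borel_measurable_times_ennreal[OF measurable_compose[OF measurable_fst borel_measurable_indicator[OF B]] indicator_cfun_measurable[OF j]]
    by (simp add: case_prod_beta')
  \<comment> \<open>A factor depending on the past alone can be taken out of
    \<open>predict\<close>.\<close>
  have pull: "predict j ?G x = indicator B x * predict j (\<lambda>x. indicator {..cfun (x j)}) x" for x
    unfolding predict_def by (cases "x \<in> B") simp_all
  have "(\<integral>\<^sup>+\<omega>. indicator B (obs j \<omega>) * indicator (cfun_event j) \<omega> \<partial>M) = (\<integral>\<^sup>+\<omega>. ?G (obs j \<omega>) (v (Suc j) \<omega>) \<partial>M)"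
    using j by (intro nn_integral_cong) (simp add: obs_def indicator_def)
  also have "\<dots> = (\<integral>\<^sup>+\<omega>. predict j ?G (obs j \<omega>) \<partial>M)"
    by (rule nn_integral_predict[OF j G])
  finally show ?thesis unfolding pull predict_obs(1)[OF j] .
qed

text \<open>The preimages under \<open>obs j\<close> form a sigma-algebra that makes each of the
  observations measurable, so it contains the generated one.\<close>

lemma sets_gen_sa_obs:
  assumes "A \<in> sets (gen_sa M v {1..j})"
  obtains B where "B \<in> sets (PiM {1..j} (\<lambda>_. borel))" "A = obs j -` B \<inter> space M"
proof -
  let ?B = "PiM {1..j} (\<lambda>_. borel :: real measure)"
  let ?V = "vimage_algebra (space M) (obs j) ?B"
  have f: "obs j \<in> space M \<rightarrow> space ?B" using measurable_space[OF obs_meas] by blast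
  have "v i \<in> borel_measurable ?V" if i: "i \<in> {1..j}" for i
  proof -
    have "(\<lambda>\<omega>. obs j \<omega> i) \<in> borel_measurable ?V"
      by (rule measurable_compose[OF measurable_vimage_algebra1[OF f] measurable_component_singleton[OF i]])
    then show ?thesis using i by (simp add: obs_def)
  qed
  then have "sets (gen_sa M v {1..j}) \<subseteq> sets ?V" by (intro sets_gen_sa_subset) simp_all
  then show ?thesis using assms that unfolding sets_vimage_algebra2[OF f] by blast
qed

lemma cfun_event_sets: "cfun_event j \<in> sets M"
  by measurable

lemma integrable_pred_formula:
  assumes j: "j \<ge> 1" shows "integrable M (pred_formula \<pi> \<nu>0 v j)"
proof (rule integrableI_bounded)
  show "pred_formula \<pi> \<nu>0 v j \<in> borel_measurable M" using j by (intro pred_formula_measurable) auto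
  have "(\<integral>\<^sup>+\<omega>. ennreal (norm (pred_formula \<pi> \<nu>0 v j \<omega>)) \<partial>M) = (\<integral>\<^sup>+\<omega>. indicator (space (PiM {1..j} (\<lambda>_. borel))) (obs j \<omega>) * indicator (cfun_event j) \<omega> \<partial>M)"
    unfolding nn_integral_pred_formula[OF j sets.top]
    using measurable_space[OF obs_meas] predict_obs(2)[OF j] by (intro nn_integral_cong) simp
  also have "\<dots> \<le> (\<integral>\<^sup>+\<omega>. 1 \<partial>M)" by (intro nn_integral_mono) (simp add: indicator_def)
  also have "\<dots> < \<infinity>" by (simp add: emeasure_space_1)
  finally show "(\<integral>\<^sup>+\<omega>. ennreal (norm (pred_formula \<pi> \<nu>0 v j \<omega>)) \<partial>M) < \<infinity>" .
qed

text \<open>\<open>nn_integral_pred_formula\<close> supplies the integrals over all conditioning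
  sets, once these are written as preimages under \<open>obs j\<close>. Nonnegativity allows passing
  between real and extended integrals.\<close>

lemma real_cond_exp_cfun_event:
  assumes j: "j \<ge> 1"
  shows "AE \<omega> in M. real_cond_exp M (gen_sa M v {1..j}) (indicator (cfun_event j)) \<omega> = pred_formula \<pi> \<nu>0 v j \<omega>"
proof -
  interpret F: finite_measure_subalgebra M "gen_sa M v {1..j}"
    by (rule subalgebra_gen_sa) simp
  show ?thesis
  proof (rule F.real_cond_exp_charact)
    show "integrable M (indicator (cfun_event j) :: 'a \<Rightarrow> real)" by (simp add: cfun_event_sets emeasure_eq_measure)
    show "integrable M (pred_formula \<pi> \<nu>0 v j)" by (rule integrable_pred_formula[OF j])
    show "pred_formula \<pi> \<nu>0 v j \<in> borel_measurable (gen_sa M v {1..j})"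
      by (rule pred_formula_measurable[OF j gen_sa_measurable])
    fix A assume A: "A \<in> sets (gen_sa M v {1..j})"
    then obtain B where B: "B \<in> sets (PiM {1..j} (\<lambda>_. borel))" "A = obs j -` B \<inter> space M"
      by (rule sets_gen_sa_obs)
    have [measurable]: "A \<in> sets M" using A F.subalg by (auto simp: subalgebra_def)
    have [measurable]: "pred_formula \<pi> \<nu>0 v j \<in> borel_measurable M" using j by (intro pred_formula_measurable) auto
    have *: "set_lebesgue_integral M A f = enn2real (\<integral>\<^sup>+\<omega>. indicator B (obs j \<omega>) * ennreal (f \<omega>) \<partial>M)"
      if f [measurable]: "f \<in> borel_measurable M" and f0: "\<And>\<omega>. 0 \<le> f \<omega>" for f :: "'a \<Rightarrow> real"
    proof -
      have "set_lebesgue_integral M A f = enn2real (\<integral>\<^sup>+\<omega>. ennreal (indicator A \<omega> *\<^sub>R f \<omega>) \<partial>M)"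
        unfolding set_lebesgue_integral_def using f0 by (intro integral_eq_nn_integral) (auto intro!: AE_I2)
      also have "(\<integral>\<^sup>+\<omega>. ennreal (indicator A \<omega> *\<^sub>R f \<omega>) \<partial>M) = (\<integral>\<^sup>+\<omega>. indicator B (obs j \<omega>) * ennreal (f \<omega>) \<partial>M)"
        by (intro nn_integral_cong) (simp add: B(2) indicator_def)
      finally show ?thesis .
    qed
    have ind: "ennreal (indicator (cfun_event j) \<omega>) = indicator (cfun_event j) \<omega>" for \<omega>
      by (simp add: indicator_def)
    show "set_lebesgue_integral M A (indicator (cfun_event j)) = set_lebesgue_integral M A (pred_formula \<pi> \<nu>0 v j)"
      using nn_integral_pred_formula[OF j B(1)] predict_obs(2)[OF j] cfun_event_sets by (simp add: * ind)
  qed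
qed

text \<open>The sticks generate a sub-sigma-algebra \<open>?G\<close> of \<open>?F\<close>, and
  \<open>v\<close> is recovered from them off a null event. So the prediction formula gets a version
  \<open>g\<close> that is measurable for \<open>?G\<close>, and the tower property brings the
  conditional expectation down from \<open>?F\<close>.\<close>

lemma real_cond_exp_stick:
  assumes j: "j \<ge> 1"
  shows "AE \<omega> in M. real_cond_exp M (gen_sa M (stick v) {1..j})
      (indicator {\<omega> \<in> space M. stick v (Suc j) \<omega> \<le> stick v j \<omega>}) \<omega> = pred_formula \<pi> \<nu>0 v j \<omega>"
proof -
  let ?F = "gen_sa M v {1..j}" and ?G = "gen_sa M (stick v) {1..j}"
  let ?S = "{\<omega> \<in> space M. stick v (Suc j) \<omega> \<le> stick v j \<omega>}"
  \<comment> \<open>The observations as functions of the sticks, by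
    \<open>one_minus_sum_stick\<close>. A denominator can be 0 only where some
    \<open>v i \<omega> = 1\<close>, which is a null event.\<close>
  define u where "u \<omega> = (\<lambda>i\<in>{1..j}. stick v i \<omega> / (1 - (\<Sum>l\<in>{1..<i}. stick v l \<omega>)))" for \<omega>
  define g where "g \<omega> = enn2real (predict j (\<lambda>x. indicator {..cfun (x j)}) (u \<omega>))" for \<omega>
  have sm [measurable]: "stick v i \<in> borel_measurable M" if "i \<ge> 1" for i
    using that by (intro stick_measurable) auto
  have smF: "stick v i \<in> borel_measurable ?F" if "i \<in> {1..j}" for i
    using that by (intro stick_measurable gen_sa_measurable) auto
  interpret F: finite_measure_subalgebra M ?F by (rule subalgebra_gen_sa) simp
  interpret G: finite_measure_subalgebra M ?G by (rule subalgebra_gen_sa) (simp add: sm)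
  have sub: "subalgebra ?F ?G"
    using sets_gen_sa_subset[of ?F M "{1..j}" "stick v"] smF by (simp add: subalgebra_def)
  have "u \<in> measurable ?G (PiM {1..j} (\<lambda>_. borel))"
    unfolding u_def[abs_def]
    by (intro measurable_restrict borel_measurable_divide borel_measurable_diff borel_measurable_const
        borel_measurable_sum gen_sa_measurable) auto
  then have gG: "g \<in> borel_measurable ?G"
    unfolding g_def[abs_def]
    by (intro borel_measurable_enn2real measurable_compose[OF _ predict_cfun_measurable[OF j]])
  then have gM: "g \<in> borel_measurable M"
    by (rule measurable_from_subalg[OF G.subalg])
  have gp: "AE \<omega> in M. g \<omega> = pred_formula \<pi> \<nu>0 v j \<omega>"
    using AE_v_neq_1[of j]
  proof eventually_elim
    fix \<omega> assume ne: "\<forall>i\<in>{1..j}. v i \<omega> \<noteq> 1"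
    have "stick v i \<omega> / (\<Prod>l\<in>{1..<i}. 1 - v l \<omega>) = v i \<omega>" if "i \<in> {1..j}" for i
    proof -
      have "(\<Prod>l\<in>{1..<i}. 1 - v l \<omega>) \<noteq> 0" using ne that by (auto simp: prod_zero_iff)
      then show ?thesis by (simp add: stick_def)
    qed
    then have "u \<omega> = obs j \<omega>"
      unfolding u_def obs_def one_minus_sum_stick by (intro restrict_ext)
    then show "g \<omega> = pred_formula \<pi> \<nu>0 v j \<omega>" by (simp add: g_def pred_formula_eq[OF j])
  qed
  have gi: "integrable M g"
    using integrable_pred_formula[OF j] by (rule integrable_cong_AE_imp) (use gp gM in auto)
  have S: "?S \<in> sets M" using j by measurable
  have Ei: "integrable M (indicator (cfun_event j) :: 'a \<Rightarrow> real)" by (simp add: cfun_event_sets emeasure_eq_measure)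
  \<comment> \<open>The stick event is first replaced by the almost surely equal event on
    observations; then follow the tower property, the conditional expectation already known, and
    measurability of \<open>g\<close>.\<close>
  have 1: "AE \<omega> in M. real_cond_exp M ?G (indicator ?S) \<omega> = real_cond_exp M ?G (indicator (cfun_event j)) \<omega>"
  proof (rule G.real_cond_exp_cong)
    show "AE \<omega> in M. indicat_real ?S \<omega> = indicat_real (cfun_event j) \<omega>"
      using AE_v_neq_1[of j] AE_space by eventually_elim (use stick_le_iff j in \<open>simp add: indicator_def\<close>)
  qed (use S cfun_event_sets in auto)
  have 2: "AE \<omega> in M. real_cond_exp M ?G (real_cond_exp M ?F (indicator (cfun_event j))) \<omega> = real_cond_exp M ?G (indicator (cfun_event j)) \<omega>"
    by (rule G.real_cond_exp_nested_subalg[OF F.subalg sub Ei])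
  have 3: "AE \<omega> in M. real_cond_exp M ?G (real_cond_exp M ?F (indicator (cfun_event j))) \<omega> = real_cond_exp M ?G g \<omega>"
  proof (rule G.real_cond_exp_cong)
    show "AE \<omega> in M. real_cond_exp M ?F (indicator (cfun_event j)) \<omega> = g \<omega>"
      using real_cond_exp_cfun_event[OF j] gp by eventually_elim simp
  qed (use gM in auto)
  have 4: "AE \<omega> in M. real_cond_exp M ?G g \<omega> = g \<omega>"
    by (rule G.real_cond_exp_F_meas[OF gi gG])
  from 1 2 3 4 gp show ?thesis by eventually_elim simp
qed

end

theorem theorem3:
  fixes M :: "'a measure" and \<nu>0 :: "real measure"
    and p eta v :: "nat \<Rightarrow> 'a \<Rightarrow> real" and \<pi> :: "nat multiset \<Rightarrow> real"
    and j :: nat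
  assumes M: "prob_space M"
    and nu0_sets: "sets \<nu>0 = sets borel"
    and nu0_prob: "prob_space \<nu>0"
    and nu0_supp: "measure \<nu>0 {0..1} = 1"
    and nu0_diffuse: "\<forall>x. measure \<nu>0 {x} = 0"
    and p_meas: "\<forall>i. p i \<in> borel_measurable M"
    and eta_meas: "\<forall>i. eta i \<in> borel_measurable M"
    and v_meas: "\<forall>i. v i \<in> borel_measurable M"
    and p_weights: "AE \<omega> in M. (\<forall>i. 0 \<le> p i \<omega>) \<and> (\<forall>n. (\<Sum>i<n. p i \<omega>) \<le> 1)"
    and eta_iid: "prob_space.indep_vars M (\<lambda>_. borel) eta UNIV"
    and eta_law: "\<forall>i. distr M borel (eta i) = \<nu>0"
    and p_eta_indep: "prob_space.indep_var M
          (PiM UNIV (\<lambda>_::nat. borel)) (\<lambda>\<omega>. \<lambda>i. p i \<omega>)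
          (PiM UNIV (\<lambda>_::nat. borel)) (\<lambda>\<omega>. \<lambda>i. eta i \<omega>)"
    and v_range: "\<forall>i\<ge>1. \<forall>\<omega>\<in>space M. v i \<omega> \<in> {0..1}"
    and v_cond_iid: "\<forall>n. \<forall>A :: nat \<Rightarrow> real set. (\<forall>i. A i \<in> sets borel) \<longrightarrow>
          (AE \<omega> in M.
             real_cond_exp M (gen_sa M (\<lambda>A \<omega>. ssp_measure \<nu>0 p eta \<omega> A) (sets borel))
               (\<lambda>\<omega>. \<Prod>i\<in>{1..n}. indicator (A i) (v i \<omega>)) \<omega>
             = (\<Prod>i\<in>{1..n}. ssp_measure \<nu>0 p eta \<omega> (A i)))"
    and eppf: "\<forall>n\<ge>1. \<forall>P. partition_on {1..n} P \<longrightarrow>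
          measure M {\<omega> \<in> space M. tie_partition v n \<omega> = P} = \<pi> (block_sizes P)"
    and j_pos: "j \<ge> 1"
  shows "(measure M {\<omega> \<in> space M. stick v (Suc j) \<omega> \<le> stick v j \<omega>}
           = \<pi> {#2#} + (1 - \<pi> {#2#}) * (\<integral>x. cdf0 \<nu>0 (cfun x) \<partial>\<nu>0))
         \<and> (AE \<omega> in M.
           real_cond_exp M (gen_sa M (stick v) {1..j})
             (indicator {\<omega> \<in> space M. stick v (Suc j) \<omega> \<le> stick v j \<omega>}) \<omega>
         = real_cond_exp M (gen_sa M v {1..j})
             (indicator {\<omega> \<in> space M. v (Suc j) \<omega> \<le> cfun (v j \<omega>)}) \<omega>
         \<and> real_cond_exp M (gen_sa M v {1..j})
             (indicator {\<omega> \<in> space M. v (Suc j) \<omega> \<le> cfun (v j \<omega>)}) \<omega>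
           = pred_formula \<pi> \<nu>0 v j \<omega>)"
proof -
  interpret M: prob_space M by (rule M)
  interpret nu: prob_space \<nu>0 by (rule nu0_prob)
  interpret ssp_sample M \<nu>0 p eta v \<pi>
    by unfold_locales (use assms in auto)
  have "AE \<omega> in M.
           real_cond_exp M (gen_sa M (stick v) {1..j})
             (indicator {\<omega> \<in> space M. stick v (Suc j) \<omega> \<le> stick v j \<omega>}) \<omega>
         = real_cond_exp M (gen_sa M v {1..j})
             (indicator {\<omega> \<in> space M. v (Suc j) \<omega> \<le> cfun (v j \<omega>)}) \<omega>
         \<and> real_cond_exp M (gen_sa M v {1..j})
             (indicator {\<omega> \<in> space M. v (Suc j) \<omega> \<le> cfun (v j \<omega>)}) \<omega>
           = pred_formula \<pi> \<nu>0 v j \<omega>"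
    using real_cond_exp_stick[OF j_pos] real_cond_exp_cfun_event[OF j_pos] by eventually_elim simp
  with prob_stick_le[OF j_pos] show ?thesis by (rule conjI)
qed

end
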